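(* Let $a>0$. Any $\alpha\in\mathbb{F}_a$ is determined by its $\mu_\alpha$; that is, if $\alpha_1,\alpha_2\in\mathbb{F}_a$ and $\mu_{\alpha_1}=\mu_{\alpha_2}$, then $\alpha_1=\alpha_2$.
   Context: For $a>0$, $\mathbb{F}_a$ is the set of finite (nonnegative) measures $\alpha$ on $(\mathbb{R},\mathscr{B}(\mathbb{R}))$ with $\alpha(\mathbb{R})=a$ and $\int_{\mathbb{R}}\log(1+|x|)\,\alpha(dx)<+\infty$. A random probability measure $\tilde\varphi$ on $(\mathbb{R},\mathscr{B}(\mathbb{R}))$ is a (functional) Dirichlet process with parameter $\alpha$ if, for every finite measurable partition $C_1,\ldots,C_{n+1}$ of $\mathbb{R}$, the vector $(\tilde\varphi(C_1),\ldots,\tilde\varphi(C_n))$ has the Dirichlet distribution with parameter $(\alpha(C_1),\ldots,\alpha(C_{n+1}))$ (components with $\alpha(C_i)=0$ being a.s. $0$); its law on the space of probability measures is denoted $\mathscr{D}_\alpha$. For $\alpha\in\mathbb{F}_a$ one has $\int|x|\,\tilde\varphi(dx)<+\infty$ a.s., and $\mu_\alpha$ denotes the probability distribution on $\mathbb{R}$ of the random mean $\tilde\varphi(I)=\int_{\mathbb{R}}x\,\tilde\varphi(dx)$ when $\tilde\varphi$ has law $\mathscr{D}_\alpha$. *)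

theory Defs
  imports "HOL-Probability.Probability"
begin

definition log_moment_measures :: "real \<Rightarrow> real measure set" where
  "log_moment_measures a =
     {\<alpha>. sets \<alpha> = sets borel \<and> emeasure \<alpha> UNIV = ennreal a \<and>
         (\<integral>\<^sup>+x. ennreal (ln (1 + \<bar>x\<bar>)) \<partial>\<alpha>) < \<infinity>}"

text \<open>
  Density, with respect to Lebesgue measure on the coordinates in \<open>J\<close>, of the Dirichlet
  distribution with strictly positive parameters \<open>p i\<close> for \<open>i \<in> J \<union> {m}\<close>, where \<open>m \<notin> J\<close>
  labels the coordinate that is one minus the sum of all the others.
\<close>

definition dirichlet_density ::
    "nat set \<Rightarrow> nat \<Rightarrow> (nat \<Rightarrow> real) \<Rightarrow> (nat \<Rightarrow> real) \<Rightarrow> real" where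
  "dirichlet_density J m p x =
     (if (\<forall>i\<in>J. 0 < x i) \<and> (\<Sum>i\<in>J. x i) < 1
      then Gamma (\<Sum>i\<in>insert m J. p i) / (\<Prod>i\<in>insert m J. Gamma (p i)) *
           (\<Prod>i\<in>J. x i powr (p i - 1)) * (1 - (\<Sum>i\<in>J. x i)) powr (p m - 1)
      else 0)"

text \<open>
  The distribution on n-dimensional space of the first \<open>n\<close> components of a Dirichlet vector with
  the \<open>n + 1\<close> nonnegative parameters \<open>p 0, \<dots>, p n\<close>, not all zero.  If all of them are positive,
  then \<open>m = n\<close>, \<open>J = {..<n}\<close>, and this is the usual distribution with density
  \<open>dirichlet_density\<close>.  Otherwise the components with parameter zero are zero, and the components
  with positive parameters are Dirichlet distributed, the one with the largest index \<open>m\<close> being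
  one minus the sum of the others.
\<close>

definition dirichlet_distribution :: "nat \<Rightarrow> (nat \<Rightarrow> real) \<Rightarrow> (nat \<Rightarrow> real) measure" where
  "dirichlet_distribution n p =
     (let P = {i. i \<le> n \<and> 0 < p i}; m = Max P; J = P - {m} in
      distr (density (\<Pi>\<^sub>M i\<in>J. lborel) (\<lambda>x. ennreal (dirichlet_density J m p x)))
        (\<Pi>\<^sub>M i\<in>{..<n}. borel)
        (\<lambda>x. \<lambda>i\<in>{..<n}. if i \<in> J then x i else if i = m then 1 - (\<Sum>j\<in>J. x j) else 0))"

definition measurable_partition :: "nat \<Rightarrow> (nat \<Rightarrow> real set) \<Rightarrow> bool" where
  "measurable_partition n C \<longleftrightarrow>
     (\<forall>i\<le>n. C i \<in> sets borel) \<and> disjoint_family_on C {..n} \<and> (\<Union>i\<le>n. C i) = UNIV"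

text \<open>
  The \<open>\<sigma>\<close>-algebra of \<open>prob_algebra borel\<close> is the one generated by the evaluations
  \<open>\<lambda>Q. measure Q C\<close>, so measurability of \<open>\<phi>\<close> says that it is a random probability measure.
\<close>

definition dirichlet_process :: "'w measure \<Rightarrow> ('w \<Rightarrow> real measure) \<Rightarrow> real measure \<Rightarrow> bool" where
  "dirichlet_process M \<phi> \<alpha> \<longleftrightarrow>
     prob_space M \<and> \<phi> \<in> M \<rightarrow>\<^sub>M prob_algebra borel \<and>
     (\<forall>n C. measurable_partition n C \<longrightarrow>
        distr M (\<Pi>\<^sub>M i\<in>{..<n}. borel) (\<lambda>\<omega>. \<lambda>i\<in>{..<n}. measure (\<phi> \<omega>) (C i)) =
        dirichlet_distribution n (\<lambda>i. measure \<alpha> (C i)))"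

text \<open>
  The distribution of the random mean.  The Bochner integral is zero where the identity is not
  integrable, which for the Dirichlet processes considered happens with probability zero only.
\<close>

definition mean_distribution :: "'w measure \<Rightarrow> ('w \<Rightarrow> real measure) \<Rightarrow> real measure" where
  "mean_distribution M \<phi> = distr M borel (\<lambda>\<omega>. \<integral>x. x \<partial>(\<phi> \<omega>))"

end

theory Submission
  imports Defs "HOL-Complex_Analysis.Complex_Analysis"
begin

text \<open>
  The law of the random mean \<open>Y\<close> determines the numbers \<open>E (1 + i s (Y - b)) powr - a\<close> for all
  real \<open>s\<close> and \<open>b\<close>, and the Markov--Krein identity (Cifarelli and Regazzini) expresses them by the
  parameter: \<open>E (1 + i s (Y - b)) powr - a = exp (- \<integral> Ln (1 + i s (x - b)) \<alpha>(dx))\<close>.  If two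
  parameters give the same law, then the two logarithmic integrals agree up to a multiple of
  \<open>2 \<pi> i\<close>.  Their imaginary parts are \<open>\<integral> arctan (s (x - b)) \<alpha>(dx)\<close>; these depend continuously on \<open>s\<close>
  and vanish at \<open>s = 0\<close>, so they agree exactly (\<open>integral_arctan_eq_if_exp_eq\<close>).  As \<open>s\<close> tends to
  infinity, \<open>arctan (s (x - b))\<close> tends to \<open>\<pi> / 2\<close> times the sign of \<open>x - b\<close>, and since the total masses
  are equal, the two measures give the same mass to every half-line
  (\<open>measure_eq_if_integral_arctan_eq\<close>).

  The Markov--Krein identity \<open>E (\<integral> f d\<phi>) powr - a = exp (- \<integral> ln f d\<alpha>)\<close> is obtained in three stages.
  For a positive simple function \<open>f\<close> it is a statement about one Dirichlet vector
  (\<open>nn_integral_dirichlet_density_powr\<close>), which holds because a Dirichlet vector multiplied by an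
  independent gamma variable has independent gamma components.  For \<open>1 + i v\<close> with a real simple
  function \<open>v\<close> it follows by analytic continuation in \<open>z\<close> from the case of \<open>1 + z v\<close> with \<open>z\<close> real and
  small (\<open>markov_krein_simple\<close>).  For an unbounded \<open>g\<close> it follows by approximation with simple functions
  (\<open>markov_krein\<close>), since the logarithmic moment makes the right-hand sides converge and, through the
  identity for \<open>1 + t \<bar>g\<bar>\<close> with \<open>t\<close> tending to zero, makes the random mean of \<open>\<bar>g\<bar>\<close> almost surely
  finite (\<open>AE_integrable_random_measure\<close>).
\<close>

section \<open>Negative powers of linear forms in a Dirichlet vector\<close>

text \<open>
  The gamma density with shape \<open>p\<close> and rate \<open>c\<close> up to the factor \<open>c powr p\<close>.  Without this factor,
  the rates of independent components combine into a linear form in the exponent.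
\<close>

definition gamma_kernel :: "real \<Rightarrow> real \<Rightarrow> real \<Rightarrow> real" where
  "gamma_kernel p c y = (if 0 < y then y powr (p - 1) * exp (- (c * y)) / Gamma p else 0)"

lemma gamma_kernel_measurable [measurable]: "gamma_kernel p c \<in> borel_measurable borel"
  unfolding gamma_kernel_def by measurable

lemma gamma_kernel_nonneg: "0 < p \<Longrightarrow> 0 \<le> gamma_kernel p c y"
  by (auto simp: gamma_kernel_def)

lemma nn_integral_gamma_kernel:
  assumes "0 < p" "0 < c"
  shows "(\<integral>\<^sup>+y. ennreal (gamma_kernel p c y) \<partial>lborel) = ennreal (c powr - p)"
proof -
  have "(\<integral>\<^sup>+y. ennreal (gamma_kernel p c y) \<partial>lborel)
      = ennreal (1 / c) * (\<integral>\<^sup>+t. ennreal (gamma_kernel p c (0 + (1 / c) * t)) \<partial>lborel)"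
    using assms by (subst nn_integral_real_affine[where c = "1 / c" and t = 0]) auto
  also have "(\<integral>\<^sup>+t. ennreal (gamma_kernel p c (0 + (1 / c) * t)) \<partial>lborel) =
      (\<integral>\<^sup>+t. ennreal (c powr (1 - p) / Gamma p) *
         ennreal (indicator {0..} t * t powr (p - 1) / exp t) \<partial>lborel)"
  proof (rule nn_integral_cong)
    fix t :: real
    have "gamma_kernel p c (0 + (1 / c) * t) =
      (c powr (1 - p) / Gamma p) * (indicator {0..} t * t powr (p - 1) / exp t)"
    proof (cases "0 < t")
      case True
      have "(t / c) powr (p - 1) = c powr (1 - p) * t powr (p - 1)"
        using True assms powr_minus[of c "p - 1"] by (simp add: powr_divide field_simps)
      then show ?thesis
        using True assms by (simp add: gamma_kernel_def exp_minus field_simps)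
    next
      case False
      then show ?thesis using assms by (auto simp: gamma_kernel_def indicator_def zero_less_divide_iff)
    qed
    then show "ennreal (gamma_kernel p c (0 + (1 / c) * t)) =
      ennreal (c powr (1 - p) / Gamma p) * ennreal (indicator {0..} t * t powr (p - 1) / exp t)"
      using assms by (simp add: ennreal_mult' flip: ennreal_mult)
  qed
  also have "\<dots> = ennreal (c powr (1 - p) / Gamma p) * ennreal (Gamma p)"
    using assms by (subst nn_integral_cmult) (auto simp: Gamma_conv_nn_integral_real)
  also have "\<dots> = ennreal (c powr (1 - p))"
    using assms Gamma_real_pos[of p] by (simp flip: ennreal_mult del: Gamma_real_pos)
  also have "ennreal (1 / c) * \<dots> = ennreal (c powr - p)"
    using assms by (simp add: powr_diff powr_minus field_simps flip: ennreal_mult)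
  finally show ?thesis .
qed

lemma nn_integral_PiM_lborel_scale:
  fixes f :: "('i \<Rightarrow> real) \<Rightarrow> ennreal"
  assumes "finite J" "0 < g" "f \<in> borel_measurable (\<Pi>\<^sub>M i\<in>J. lborel)"
  shows "(\<integral>\<^sup>+x. f x \<partial>(\<Pi>\<^sub>M i\<in>J. lborel)) =
         ennreal (g ^ card J) * (\<integral>\<^sup>+x. f (\<lambda>i\<in>J. g * x i) \<partial>(\<Pi>\<^sub>M i\<in>J. lborel))"
  using assms(1,3)
proof (induction J arbitrary: f rule: finite_induct)
  case empty
  then show ?case by (simp add: nn_integral_count_space_finite PiM_empty)
next
  case (insert i J)
  interpret product_sigma_finite "\<lambda>_::'i. lborel :: real measure" by standard
  note [measurable] = insert.prems
  note [simp] = insert.hyps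
  have "(\<integral>\<^sup>+x. f x \<partial>(\<Pi>\<^sub>M i\<in>insert i J. lborel)) =
      (\<integral>\<^sup>+x. (\<integral>\<^sup>+y. f (x(i := y)) \<partial>lborel) \<partial>(\<Pi>\<^sub>M i\<in>J. lborel))"
    by (rule product_nn_integral_insert) auto
  also have "\<dots> = (\<integral>\<^sup>+x. ennreal g * (\<integral>\<^sup>+y. f (x(i := g * y)) \<partial>lborel) \<partial>(\<Pi>\<^sub>M i\<in>J. lborel))"
    using assms(2)
    by (intro nn_integral_cong, subst nn_integral_real_affine[where c = g and t = 0]) auto
  also have "\<dots> = ennreal g * (\<integral>\<^sup>+x. (\<integral>\<^sup>+y. f (x(i := g * y)) \<partial>lborel) \<partial>(\<Pi>\<^sub>M i\<in>J. lborel))"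
    by (rule nn_integral_cmult) measurable
  also have "(\<integral>\<^sup>+x. (\<integral>\<^sup>+y. f (x(i := g * y)) \<partial>lborel) \<partial>(\<Pi>\<^sub>M i\<in>J. lborel)) =
      ennreal (g ^ card J) * (\<integral>\<^sup>+x.
      (\<integral>\<^sup>+y. f ((\<lambda>j\<in>J. g * x j)(i := g * y)) \<partial>lborel) \<partial>(\<Pi>\<^sub>M i\<in>J. lborel))"
    by (rule insert.IH) measurable
  also have "(\<integral>\<^sup>+x. (\<integral>\<^sup>+y. f ((\<lambda>j\<in>J. g * x j)(i := g * y)) \<partial>lborel) \<partial>(\<Pi>\<^sub>M i\<in>J. lborel)) =
      (\<integral>\<^sup>+x. (\<integral>\<^sup>+y. f (\<lambda>j\<in>insert i J. g * (x(i := y)) j) \<partial>lborel) \<partial>(\<Pi>\<^sub>M i\<in>J. lborel))"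
    by (intro nn_integral_cong arg_cong[where f = f]) (auto simp: fun_eq_iff restrict_def)
  also have "\<dots> = (\<integral>\<^sup>+x. f (\<lambda>j\<in>insert i J. g * x j) \<partial>(\<Pi>\<^sub>M i\<in>insert i J. lborel))"
    by (rule product_nn_integral_insert[symmetric]) auto
  moreover have "ennreal (g ^ card (insert i J)) = ennreal g * ennreal (g ^ card J)"
    using assms(2) by (simp add: ennreal_mult)
  ultimately show ?case by (simp only: mult.assoc)
qed

lemma dirichlet_density_measurable [measurable]:
  "finite J \<Longrightarrow> dirichlet_density J m p \<in> borel_measurable (\<Pi>\<^sub>M i\<in>J. lborel)"
  unfolding dirichlet_density_def by measurable

lemma dirichlet_density_nonneg:
  assumes "finite J" "\<And>i. i \<in> insert m J \<Longrightarrow> 0 < p i"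
  shows "0 \<le> dirichlet_density J m p x"
proof -
  have "0 < (\<Sum>i\<in>insert m J. p i)" using assms by (intro sum_pos) auto
  then have "0 < Gamma (\<Sum>i\<in>insert m J. p i)" "0 < (\<Prod>i\<in>insert m J. Gamma (p i))"
    using assms by (auto intro!: prod_pos Gamma_real_pos simp del: sum.insert)
  then show ?thesis
    unfolding dirichlet_density_def
    by (auto intro!: mult_nonneg_nonneg divide_nonneg_pos prod_nonneg)
qed

text \<open>
  The Jacobian computation behind the independence of the normalised vector and the sum of
  independent gamma variables: in the coordinates \<open>g x\<^sub>i\<close> the product of the gamma kernels separates
  into a Dirichlet density in \<open>x\<close> and a gamma kernel in the sum \<open>g\<close>, whose rate is the linear form.
\<close>

lemma gamma_kernels_eq_dirichlet_density:
  assumes fin: "finite J" and m: "m \<notin> J" and p: "\<And>i. i \<in> insert m J \<Longrightarrow> 0 < p i" and g: "0 < g"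
  shows "g ^ card J * (gamma_kernel (p m) (c m) (g * (1 - (\<Sum>i\<in>J. x i))) *
           (\<Prod>i\<in>J. gamma_kernel (p i) (c i) (g * x i))) =
         dirichlet_density J m p x * gamma_kernel (\<Sum>i\<in>insert m J. p i)
           ((\<Sum>i\<in>J. c i * x i) + c m * (1 - (\<Sum>i\<in>J. x i))) g"
proof (cases "(\<forall>i\<in>J. 0 < x i) \<and> (\<Sum>i\<in>J. x i) < 1")
  case False
  then consider i where "i \<in> J" "\<not> 0 < x i" | "\<not> (\<Sum>i\<in>J. x i) < 1" by blast
  then have "gamma_kernel (p m) (c m) (g * (1 - (\<Sum>i\<in>J. x i))) *
           (\<Prod>i\<in>J. gamma_kernel (p i) (c i) (g * x i)) = 0"
  proof cases
    case 1
    then have "(\<Prod>i\<in>J. gamma_kernel (p i) (c i) (g * x i)) = 0"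
      using fin g by (intro prod_zero) (auto simp: gamma_kernel_def zero_less_mult_iff)
    then show ?thesis by simp
  next
    case 2
    then show ?thesis using g by (simp add: gamma_kernel_def zero_less_mult_iff)
  qed
  then show ?thesis using False by (auto simp: dirichlet_density_def)
next
  case True
  define u where "u = 1 - (\<Sum>i\<in>J. x i)"
  have u: "0 < u" using True by (simp add: u_def)
  have "(\<Prod>i\<in>J. gamma_kernel (p i) (c i) (g * x i)) =
     (\<Prod>i\<in>J. g powr (p i - 1) * (x i powr (p i - 1)) * exp (- (g * (c i * x i))) / Gamma (p i))"
    using True g by (intro prod.cong) (auto simp: gamma_kernel_def powr_mult mult_ac)
  also have "\<dots> = g powr (\<Sum>i\<in>J. p i - 1) * (\<Prod>i\<in>J. x i powr (p i - 1)) *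
     exp (- (g * (\<Sum>i\<in>J. c i * x i))) / (\<Prod>i\<in>J. Gamma (p i))"
    using fin g by (simp add: prod_dividef prod.distrib powr_sum exp_sum sum_distrib_left
      flip: sum_negf)
  finally have 1: "(\<Prod>i\<in>J. gamma_kernel (p i) (c i) (g * x i)) = \<dots>" .
  have 2: "gamma_kernel (p m) (c m) (g * u) =
      g powr (p m - 1) * u powr (p m - 1) * exp (- (g * (c m * u))) / Gamma (p m)"
    using u g by (simp add: gamma_kernel_def powr_mult mult_ac)
  have 3: "g ^ card J * (g powr (p m - 1) * g powr (\<Sum>i\<in>J. p i - 1)) =
      g powr ((\<Sum>i\<in>insert m J. p i) - 1)"
    using g fin m by (simp add: sum_subtractf algebra_simps flip: powr_realpow powr_add)
  have 4: "exp (- (g * (c m * u))) * exp (- (g * (\<Sum>i\<in>J. c i * x i))) =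
      exp (- (((\<Sum>i\<in>J. c i * x i) + c m * u) * g))"
    by (simp add: algebra_simps flip: exp_add)
  have pos: "0 < (\<Sum>i\<in>insert m J. p i)" using p fin by (intro sum_pos) auto
  have "g ^ card J * (gamma_kernel (p m) (c m) (g * u) *
           (\<Prod>i\<in>J. gamma_kernel (p i) (c i) (g * x i))) =
     (g ^ card J * (g powr (p m - 1) * g powr (\<Sum>i\<in>J. p i - 1))) *
     ((\<Prod>i\<in>J. x i powr (p i - 1)) * u powr (p m - 1)) *
     (exp (- (g * (c m * u))) * exp (- (g * (\<Sum>i\<in>J. c i * x i)))) /
     (Gamma (p m) * (\<Prod>i\<in>J. Gamma (p i)))"
    unfolding 1 2 by (simp add: mult_ac)
  also have "\<dots> = dirichlet_density J m p x * gamma_kernel (\<Sum>i\<in>insert m J. p i)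
           ((\<Sum>i\<in>J. c i * x i) + c m * u) g"
    unfolding 3 4 using True g fin m Gamma_real_pos[OF pos]
    by (simp add: dirichlet_density_def gamma_kernel_def u_def)
  finally show ?thesis unfolding u_def .
qed

text \<open>
  The right-hand side is a product of gamma integrals, hence one integral of a product over
  independent gamma variables.  Passing to their sum \<open>g\<close> and their proportions \<open>x\<close>, and integrating
  \<open>g\<close> out for fixed \<open>x\<close>, leaves the power of the linear form.  All integrands are nonnegative, so the
  order of integration is free.
\<close>

proposition nn_integral_dirichlet_density_powr:
  assumes fin: "finite J" and m: "m \<notin> J"
    and p: "\<And>i. i \<in> insert m J \<Longrightarrow> 0 < p i" and c: "\<And>i. i \<in> insert m J \<Longrightarrow> 0 < c i"
  shows "(\<integral>\<^sup>+x. ennreal (dirichlet_density J m p x) *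
           ennreal (((\<Sum>i\<in>J. c i * x i) + c m * (1 - (\<Sum>i\<in>J. x i))) powr - (\<Sum>i\<in>insert m J. p i))
           \<partial>(\<Pi>\<^sub>M i\<in>J. lborel)) = ennreal (\<Prod>i\<in>insert m J. c i powr - p i)"
proof -
  interpret product_sigma_finite "\<lambda>_::nat. lborel :: real measure" by standard
  interpret J: finite_product_sigma_finite "\<lambda>_::nat. lborel :: real measure" J by standard fact
  interpret P: pair_sigma_finite "\<Pi>\<^sub>M i\<in>J. lborel :: real measure" lborel
    by (intro pair_sigma_finite.intro J.sigma_finite_measure_axioms sigma_finite_lborel)
  note [simp] = fin m
  let ?k = "\<lambda>i y. ennreal (gamma_kernel (p i) (c i) y)"
  let ?a = "\<Sum>i\<in>insert m J. p i"
  let ?S = "\<lambda>x. (\<Sum>i\<in>J. c i * x i) + c m * (1 - (\<Sum>i\<in>J. x i))"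
  have a: "0 < ?a" using p by (intro sum_pos) auto
  have "ennreal (\<Prod>i\<in>insert m J. c i powr - p i) = (\<Prod>i\<in>insert m J. \<integral>\<^sup>+y. ?k i y \<partial>lborel)"
    using p c by (simp add: nn_integral_gamma_kernel prod_ennreal ennreal_mult prod_nonneg)
  also have "\<dots> = (\<integral>\<^sup>+y. (\<Prod>i\<in>insert m J. ?k i (y i)) \<partial>(\<Pi>\<^sub>M i\<in>insert m J. lborel))"
    by (rule product_nn_integral_prod[symmetric]) auto
  also have "\<dots> = (\<integral>\<^sup>+y. (\<integral>\<^sup>+z. (\<Prod>i\<in>insert m J. ?k i ((y(m := z)) i)) \<partial>lborel) \<partial>(\<Pi>\<^sub>M i\<in>J. lborel))"
    by (rule product_nn_integral_insert) auto
  also have "\<dots> = (\<integral>\<^sup>+y. (\<integral>\<^sup>+z. ?k m z * (\<Prod>i\<in>J. ?k i (y i)) \<partial>lborel) \<partial>(\<Pi>\<^sub>M i\<in>J. lborel))"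
    using m by (intro nn_integral_cong) (auto intro!: prod.cong arg_cong2[where f = "(*)"])
  \<comment> \<open>The last gamma variable is replaced by the sum \<open>g\<close> of all of them.\<close>
  also have "\<dots> = (\<integral>\<^sup>+y. (\<integral>\<^sup>+g. ?k m (g - (\<Sum>i\<in>J. y i)) * (\<Prod>i\<in>J. ?k i (y i)) \<partial>lborel) \<partial>(\<Pi>\<^sub>M i\<in>J. lborel))"
  proof (rule nn_integral_cong)
    fix y :: "nat \<Rightarrow> real"
    show "(\<integral>\<^sup>+z. ?k m z * (\<Prod>i\<in>J. ?k i (y i)) \<partial>lborel) =
      (\<integral>\<^sup>+g. ?k m (g - (\<Sum>i\<in>J. y i)) * (\<Prod>i\<in>J. ?k i (y i)) \<partial>lborel)"
      by (subst nn_integral_real_affine[where c = 1 and t = "- (\<Sum>i\<in>J. y i)"]) auto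
  qed
  also have "\<dots> = (\<integral>\<^sup>+g. (\<integral>\<^sup>+y. ?k m (g - (\<Sum>i\<in>J. y i)) * (\<Prod>i\<in>J. ?k i (y i)) \<partial>(\<Pi>\<^sub>M i\<in>J. lborel)) \<partial>lborel)"
    by (rule P.Fubini'[symmetric]) measurable
  also have "\<dots> = (\<integral>\<^sup>+g. (\<integral>\<^sup>+x. ennreal (dirichlet_density J m p x) *
      ennreal (gamma_kernel ?a (?S x) g) \<partial>(\<Pi>\<^sub>M i\<in>J. lborel)) \<partial>lborel)"
  proof (rule nn_integral_cong)
    fix g :: real
    show "(\<integral>\<^sup>+y. ?k m (g - (\<Sum>i\<in>J. y i)) * (\<Prod>i\<in>J. ?k i (y i)) \<partial>(\<Pi>\<^sub>M i\<in>J. lborel)) =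
      (\<integral>\<^sup>+x. ennreal (dirichlet_density J m p x) *
      ennreal (gamma_kernel ?a (?S x) g) \<partial>(\<Pi>\<^sub>M i\<in>J. lborel))"
    proof (cases "0 < g")
      case False
      have *: "?k m (g - (\<Sum>i\<in>J. y i)) * (\<Prod>i\<in>J. ?k i (y i)) = 0" for y
      proof (cases "\<forall>i\<in>J. 0 < y i")
        case True
        then have "0 \<le> (\<Sum>i\<in>J. y i)" by (intro sum_nonneg) auto
        then show ?thesis using False by (simp add: gamma_kernel_def)
      next
        case False
        then have "(\<Prod>i\<in>J. ?k i (y i)) = 0"
          by (intro prod_zero) (auto simp: gamma_kernel_def)
        then show ?thesis by simp
      qed
      have "gamma_kernel ?a (?S x) g = 0" for x using False by (simp add: gamma_kernel_def)
      with * show ?thesis by (simp only: ennreal_0 mult_zero_right)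
    next
      case True
      \<comment> \<open>For a fixed sum \<open>g\<close> the proportions are \<open>x = y / g\<close>.\<close>
      have "(\<integral>\<^sup>+y. ?k m (g - (\<Sum>i\<in>J. y i)) * (\<Prod>i\<in>J. ?k i (y i)) \<partial>(\<Pi>\<^sub>M i\<in>J. lborel)) =
        ennreal (g ^ card J) * (\<integral>\<^sup>+x. ?k m (g - (\<Sum>i\<in>J. (\<lambda>i\<in>J. g * x i) i)) *
          (\<Prod>i\<in>J. ?k i ((\<lambda>i\<in>J. g * x i) i)) \<partial>(\<Pi>\<^sub>M i\<in>J. lborel))"
        using True by (intro nn_integral_PiM_lborel_scale) auto
      also have "\<dots> = ennreal (g ^ card J) * (\<integral>\<^sup>+x. ?k m (g * (1 - (\<Sum>i\<in>J. x i))) *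
          (\<Prod>i\<in>J. ?k i (g * x i)) \<partial>(\<Pi>\<^sub>M i\<in>J. lborel))"
        by (simp add: sum_distrib_left right_diff_distrib)
      also have "\<dots> = (\<integral>\<^sup>+x. ennreal (g ^ card J) * (?k m (g * (1 - (\<Sum>i\<in>J. x i))) *
          (\<Prod>i\<in>J. ?k i (g * x i))) \<partial>(\<Pi>\<^sub>M i\<in>J. lborel))"
        by (rule nn_integral_cmult[symmetric]) auto
      also have "\<dots> = (\<integral>\<^sup>+x. ennreal (dirichlet_density J m p x) *
          ennreal (gamma_kernel ?a (?S x) g) \<partial>(\<Pi>\<^sub>M i\<in>J. lborel))"
      proof (rule nn_integral_cong)
        fix x
        have "ennreal (g ^ card J) * (?k m (g * (1 - (\<Sum>i\<in>J. x i))) * (\<Prod>i\<in>J. ?k i (g * x i))) =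
          ennreal (g ^ card J * (gamma_kernel (p m) (c m) (g * (1 - (\<Sum>i\<in>J. x i))) *
           (\<Prod>i\<in>J. gamma_kernel (p i) (c i) (g * x i))))"
          using True p by (subst prod_ennreal)
            (auto simp: gamma_kernel_nonneg prod_nonneg ennreal_mult)
        also have "\<dots> = ennreal (dirichlet_density J m p x * gamma_kernel ?a (?S x) g)"
          by (subst gamma_kernels_eq_dirichlet_density) (use p True in auto)
        also have "\<dots> = ennreal (dirichlet_density J m p x) * ennreal (gamma_kernel ?a (?S x) g)"
          by (intro ennreal_mult dirichlet_density_nonneg gamma_kernel_nonneg a) (use p in auto)
        finally show "ennreal (g ^ card J) *
            (?k m (g * (1 - (\<Sum>i\<in>J. x i))) * (\<Prod>i\<in>J. ?k i (g * x i))) = \<dots>" .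
      qed
      finally show ?thesis .
    qed
  qed
  also have "\<dots> = (\<integral>\<^sup>+x. (\<integral>\<^sup>+g. ennreal (dirichlet_density J m p x) *
      ennreal (gamma_kernel ?a (?S x) g) \<partial>lborel) \<partial>(\<Pi>\<^sub>M i\<in>J. lborel))"
    unfolding gamma_kernel_def by (rule P.Fubini') measurable
  also have "\<dots> = (\<integral>\<^sup>+x. ennreal (dirichlet_density J m p x) * ennreal (?S x powr - ?a) \<partial>(\<Pi>\<^sub>M i\<in>J. lborel))"
  proof (rule nn_integral_cong)
    fix x
    show "(\<integral>\<^sup>+g. ennreal (dirichlet_density J m p x) * ennreal (gamma_kernel ?a (?S x) g) \<partial>lborel) =
      ennreal (dirichlet_density J m p x) * ennreal (?S x powr - ?a)"
    proof (cases "(\<forall>i\<in>J. 0 < x i) \<and> (\<Sum>i\<in>J. x i) < 1")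
      case True
      then have "0 < ?S x"
        using c by (intro add_nonneg_pos sum_nonneg mult_pos_pos)
          (auto intro!: mult_nonneg_nonneg less_imp_le)
      then show ?thesis
        using a by (subst nn_integral_cmult) (auto simp: nn_integral_gamma_kernel simp del: sum.insert)
    qed (auto simp: dirichlet_density_def)
  qed
  finally show ?thesis by simp
qed

section \<open>Simple functions of the random measure\<close>

lemma simple_function_partition:
  fixes f :: "real \<Rightarrow> real"
  assumes "simple_function borel f"
  obtains n C c where "measurable_partition n C" "\<And>i x. i \<le> n \<Longrightarrow> x \<in> C i \<Longrightarrow> f x = c i"
    "\<And>i. i \<le> n \<Longrightarrow> c i \<in> range f"
proof -
  have fin: "finite (range f)" using simple_functionD(1)[OF assms] by simp
  obtain c where c: "bij_betw c {0..<card (range f)} (range f)"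
    using ex_bij_betw_nat_finite[OF fin] by blast
  obtain n where n: "card (range f) = Suc n"
    using fin by (cases "card (range f)") auto
  have c: "bij_betw c {..n} (range f)"
    using c unfolding n by (simp add: atLeast0LessThan lessThan_Suc_atMost)
  show ?thesis
  proof
    show "measurable_partition n (\<lambda>i. f -` {c i})"
      unfolding measurable_partition_def
    proof (intro conjI allI impI)
      show "f -` {c i} \<in> sets borel" for i using simple_functionD(2)[OF assms, of "{c i}"] by simp
      show "disjoint_family_on (\<lambda>i. f -` {c i}) {..n}"
        using c by (auto simp: disjoint_family_on_def bij_betw_def inj_on_def)
      show "(\<Union>i\<le>n. f -` {c i}) = UNIV"
        using c unfolding bij_betw_def by (auto simp: set_eq_iff)
    qed
  qed (use c in \<open>auto simp: bij_betw_def\<close>)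
qed

lemma has_bochner_integral_partition:
  fixes g :: "real \<Rightarrow> real"
  assumes "finite_measure Q" "sets Q = sets borel" "measurable_partition n C"
    and g: "\<And>i x. i \<le> n \<Longrightarrow> x \<in> C i \<Longrightarrow> g x = d i"
  shows "has_bochner_integral Q g (\<Sum>i\<le>n. d i * measure Q (C i))"
proof -
  interpret finite_measure Q by fact
  note C = assms(3)[unfolded measurable_partition_def]
  have eq: "g x = (\<Sum>i\<le>n. d i * indicator (C i) x)" for x
  proof -
    obtain j where j: "j \<le> n" "x \<in> C j" using C by (auto simp: set_eq_iff)
    have "(\<Sum>i\<le>n. d i * indicator (C i) x) = (\<Sum>i\<le>n. if i = j then d j else 0)"
      using C j by (intro sum.cong) (auto simp: disjoint_family_on_def indicator_def)
    also have "\<dots> = g x" using j g by simp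
    finally show ?thesis by simp
  qed
  show ?thesis
    unfolding eq using C assms(2)
    by (intro has_bochner_integral_sum has_bochner_integral_mult_right has_bochner_integral_real_indicator)
      (auto simp: less_top[symmetric])
qed

lemma measure_partition_sum:
  assumes "finite_measure Q" "sets Q = sets borel" "measurable_partition n C"
  shows "(\<Sum>i\<le>n. measure Q (C i)) = measure Q UNIV"
proof -
  interpret finite_measure Q by fact
  show ?thesis
    using assms(2,3) finite_measure_finite_Union[of "{..n}" C]
    by (auto simp: measurable_partition_def image_subset_iff)
qed

locale dirichlet_random_measure =
  fixes M :: "'w measure" and \<phi> :: "'w \<Rightarrow> real measure" and \<alpha> :: "real measure" and a :: real
  assumes process: "dirichlet_process M \<phi> \<alpha>"
    and sets_param: "sets \<alpha> = sets borel"
    and total_mass: "emeasure \<alpha> UNIV = ennreal a"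
    and a_pos: "0 < a"

sublocale dirichlet_random_measure \<subseteq> prob_space M
  using process by (simp add: dirichlet_process_def)

sublocale dirichlet_random_measure \<subseteq> \<alpha>: finite_measure \<alpha>
  using sets_eq_imp_space_eq[OF sets_param] total_mass by (intro finite_measureI) auto

context dirichlet_random_measure
begin

lemma random_measure_measurable [measurable]: "\<phi> \<in> M \<rightarrow>\<^sub>M subprob_algebra borel"
  using process by (auto simp: dirichlet_process_def intro: measurable_prob_algebraD)

lemma
  assumes "\<omega> \<in> space M"
  shows prob_space_random_measure: "prob_space (\<phi> \<omega>)"
    and sets_random_measure: "sets (\<phi> \<omega>) = sets borel"
  using process assms measurable_space[of \<phi> M "prob_algebra borel" \<omega>]
  by (auto simp: dirichlet_process_def space_prob_algebra)

lemma measure_param_UNIV: "measure \<alpha> UNIV = a"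
  using total_mass a_pos by (simp add: measure_def)

lemma finite_dimensional_law:
  assumes "measurable_partition n C"
  shows "distr M (\<Pi>\<^sub>M i\<in>{..<n}. borel) (\<lambda>\<omega>. \<lambda>i\<in>{..<n}. measure (\<phi> \<omega>) (C i)) =
         dirichlet_distribution n (\<lambda>i. measure \<alpha> (C i))"
  using process assms unfolding dirichlet_process_def by blast

text \<open>
  The level sets of \<open>f\<close> form a finite partition, so the mean of \<open>f\<close> is a linear form in a
  Dirichlet vector.  The level sets without mass under the parameter drop out on both sides.
\<close>

lemma nn_integral_simple_mean_powr:
  fixes f :: "real \<Rightarrow> real"
  assumes f: "simple_function borel f" and pos: "\<And>x. 0 < f x"
  shows "(\<integral>\<^sup>+\<omega>. ennreal ((\<integral>x. f x \<partial>\<phi> \<omega>) powr - a) \<partial>M) = ennreal (exp (- (\<integral>x. ln (f x) \<partial>\<alpha>)))"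
proof -
  obtain n C c where part: "measurable_partition n C"
    and fc: "\<And>i x. i \<le> n \<Longrightarrow> x \<in> C i \<Longrightarrow> f x = c i"
    and cr: "\<And>i. i \<le> n \<Longrightarrow> c i \<in> range f"
    using simple_function_partition[OF f] by metis
  have c: "0 < c i" if "i \<le> n" for i using cr[OF that] pos by auto
  have Cm [measurable]: "C i \<in> sets borel" if "i < n" for i
    using that part by (auto simp: measurable_partition_def)
  define p where "p i = measure \<alpha> (C i)" for i
  define P where "P = {i. i \<le> n \<and> 0 < p i}"
  define m where "m = Max P"
  define J where "J = P - {m}"
  have sum_p: "(\<Sum>i\<le>n. p i) = a"
    unfolding p_def measure_param_UNIV[symmetric]
    by (rule measure_partition_sum[OF \<alpha>.finite_measure_axioms sets_param part])
  have p_nonneg: "0 \<le> p i" for i by (simp add: p_def)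
  have finP: "finite P" by (simp add: P_def)
  have "P \<noteq> {}"
  proof
    assume "P = {}"
    then have "(\<Sum>i\<le>n. p i) = 0" using p_nonneg
      by (intro sum.neutral) (auto simp: P_def order.antisym not_less)
    with sum_p a_pos show False by simp
  qed
  then have mP: "m \<in> P" using finP by (auto simp: m_def)
  have PJ: "insert m J = P" using mP by (auto simp: J_def)
  have J: "finite J" "m \<notin> J" using finP by (auto simp: J_def)
  have Jn: "i < n" if "i \<in> J" for i
  proof -
    have "i \<le> m" using that finP by (auto simp: J_def m_def)
    then show ?thesis using that mP by (auto simp: J_def P_def)
  qed
  have sum_P: "(\<Sum>i\<in>P. p i) = a"
    unfolding sum_p[symmetric]
    by (rule sum.mono_neutral_left) (use p_nonneg in \<open>auto simp: P_def not_less order.antisym\<close>)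
  define T where
    "T x = (\<lambda>i\<in>{..<n}. if i \<in> J then x i else if i = m then 1 - (\<Sum>j\<in>J. x j) else 0)"
    for x :: "nat \<Rightarrow> real"
  have T_sum: "(\<Sum>i<n. d i * T x i) =
      (\<Sum>i\<in>J. d i * x i) + (if m < n then d m * (1 - (\<Sum>i\<in>J. x i)) else 0)" for d x
  proof -
    have "(\<Sum>i<n. d i * T x i) = (\<Sum>i<n. (if i \<in> J then d i * x i else 0) +
        (if i = m then d m * (1 - (\<Sum>i\<in>J. x i)) else 0))"
      using J by (intro sum.cong) (auto simp: T_def)
    also have "\<dots> = (\<Sum>i<n. if i \<in> J then d i * x i else 0) +
        (if m < n then d m * (1 - (\<Sum>i\<in>J. x i)) else 0)"
      by (simp add: sum.distrib)
    also have "(\<Sum>i<n. if i \<in> J then d i * x i else 0) = (\<Sum>i\<in>J. d i * x i)"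
      using J Jn by (subst sum.inter_restrict[symmetric]) (auto intro!: sum.cong)
    finally show ?thesis .
  qed
  define F where "F v = ennreal (((\<Sum>i<n. c i * v i) + c n * (1 - (\<Sum>i<n. v i))) powr - a)"
    for v :: "nat \<Rightarrow> real"
  have F_meas [measurable]: "F \<in> borel_measurable (\<Pi>\<^sub>M i\<in>{..<n}. borel)"
    unfolding F_def by measurable
  \<comment> \<open>The component \<open>n\<close> is recovered as one minus the others.  It is the component \<open>m\<close> if \<open>m = n\<close>,
    and it is zero if \<open>m < n\<close>; the linear form is the same in both cases.\<close>
  have FT: "F (T x) = ennreal (((\<Sum>i\<in>J. c i * x i) + c m * (1 - (\<Sum>i\<in>J. x i))) powr - a)" for x
  proof (cases "m < n")
    case True
    then show ?thesis using T_sum[of c x] T_sum[of "\<lambda>_. 1" x] by (simp add: F_def)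
  next
    case False
    then have "m = n" using mP by (auto simp: P_def)
    then show ?thesis using T_sum[of c x] T_sum[of "\<lambda>_. 1" x] by (simp add: F_def)
  qed
  have law: "dirichlet_distribution n p = distr (density (\<Pi>\<^sub>M i\<in>J. lborel)
      (\<lambda>x. ennreal (dirichlet_density J m p x))) (\<Pi>\<^sub>M i\<in>{..<n}. borel) T"
    unfolding dirichlet_distribution_def Let_def P_def[symmetric] m_def[symmetric] J_def[symmetric]
      T_def[abs_def] ..
  have T_meas [measurable]: "T \<in> (\<Pi>\<^sub>M i\<in>J. lborel) \<rightarrow>\<^sub>M (\<Pi>\<^sub>M i\<in>{..<n}. borel)"
    unfolding T_def[abs_def]
  proof (rule measurable_restrict)
    fix i assume "i \<in> {..<n}"
    show "(\<lambda>x. if i \<in> J then x i else if i = m then 1 - (\<Sum>j\<in>J. x j) else 0)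
      \<in> borel_measurable (\<Pi>\<^sub>M i\<in>J. lborel)"
      by (cases "i \<in> J"; cases "i = m") auto
  qed
  have D_meas [measurable]: "dirichlet_density J m p \<in> borel_measurable (\<Pi>\<^sub>M i\<in>J. lborel)"
    using J by simp
  have "(\<integral>\<^sup>+\<omega>. ennreal ((\<integral>x. f x \<partial>\<phi> \<omega>) powr - a) \<partial>M) =
      (\<integral>\<^sup>+\<omega>. F (\<lambda>i\<in>{..<n}. measure (\<phi> \<omega>) (C i)) \<partial>M)"
  proof (rule nn_integral_cong)
    fix \<omega> assume \<omega>: "\<omega> \<in> space M"
    interpret \<phi>: prob_space "\<phi> \<omega>" by (rule prob_space_random_measure[OF \<omega>])
    note part' = \<phi>.finite_measure_axioms sets_random_measure[OF \<omega>] part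
    have "(\<integral>x. f x \<partial>\<phi> \<omega>) = (\<Sum>i\<le>n. c i * measure (\<phi> \<omega>) (C i))"
      by (rule has_bochner_integral_integral_eq[OF has_bochner_integral_partition[OF part' fc]])
    moreover have "(\<Sum>i\<le>n. measure (\<phi> \<omega>) (C i)) = 1"
      using measure_partition_sum[OF part'] \<phi>.prob_space
        sets_eq_imp_space_eq[OF sets_random_measure[OF \<omega>]] by simp
    ultimately show "ennreal ((\<integral>x. f x \<partial>\<phi> \<omega>) powr - a) = F (\<lambda>i\<in>{..<n}. measure (\<phi> \<omega>) (C i))"
      by (simp add: F_def lessThan_Suc_atMost[symmetric] add.commute eq_diff_eq[symmetric])
  qed
  also have "\<dots> = (\<integral>\<^sup>+v. F v \<partial>distr M (\<Pi>\<^sub>M i\<in>{..<n}. borel) (\<lambda>\<omega>. \<lambda>i\<in>{..<n}. measure (\<phi> \<omega>) (C i)))"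
    by (rule nn_integral_distr[symmetric]) measurable
  also have "\<dots> = (\<integral>\<^sup>+v. F v \<partial>dirichlet_distribution n p)"
    unfolding finite_dimensional_law[OF part] p_def[abs_def] ..
  also have "\<dots> = (\<integral>\<^sup>+x. ennreal (dirichlet_density J m p x) * F (T x) \<partial>(\<Pi>\<^sub>M i\<in>J. lborel))"
    unfolding law by (subst nn_integral_distr) (auto simp: nn_integral_density)
  also have "\<dots> = ennreal (\<Prod>i\<in>P. c i powr - p i)"
    unfolding FT sum_P[symmetric] unfolding PJ[symmetric]
    by (rule nn_integral_dirichlet_density_powr[OF J]) (use c in \<open>auto simp: PJ P_def\<close>)
  also have "(\<Prod>i\<in>P. c i powr - p i) = exp (- (\<Sum>i\<in>P. ln (c i) * p i))"
  proof -
    have "c i powr - p i = exp (- (ln (c i) * p i))" if "i \<in> P" for i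
      using that c[of i] by (simp add: powr_def P_def mult.commute)
    then show ?thesis using finP by (simp add: exp_sum flip: sum_negf)
  qed
  also have "(\<Sum>i\<in>P. ln (c i) * p i) = (\<Sum>i\<le>n. ln (c i) * p i)"
    by (rule sum.mono_neutral_left) (use p_nonneg in \<open>auto simp: P_def not_less order.antisym\<close>)
  also have "\<dots> = (\<integral>x. ln (f x) \<partial>\<alpha>)"
    unfolding p_def
    by (rule has_bochner_integral_integral_eq[symmetric, OF has_bochner_integral_partition
      [OF \<alpha>.finite_measure_axioms sets_param part]]) (simp add: fc)
  finally show ?thesis .
qed

lemma random_mean_measurable [measurable]:
  fixes f :: "real \<Rightarrow> 'b :: {banach, second_countable_topology}"
  assumes [measurable]: "f \<in> borel_measurable borel"
  shows "(\<lambda>\<omega>. \<integral>x. f x \<partial>\<phi> \<omega>) \<in> borel_measurable M"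
  by measurable

lemma expectation_simple_mean_powr:
  fixes f :: "real \<Rightarrow> real"
  assumes f: "simple_function borel f" and pos: "\<And>x. 0 < f x"
  shows "(\<integral>\<omega>. (\<integral>x. f x \<partial>\<phi> \<omega>) powr - a \<partial>M) = exp (- (\<integral>x. ln (f x) \<partial>\<alpha>))"
proof -
  have [measurable]: "f \<in> borel_measurable borel" by (rule borel_measurable_simple_function[OF f])
  show ?thesis
    by (subst integral_eq_nn_integral) (auto simp: nn_integral_simple_mean_powr[OF assms])
qed

end

section \<open>Holomorphic dependence of integrals on a parameter\<close>

text \<open>
  Cauchy's inequality turns the uniform bound on the integrand into a uniform bound on its
  derivative near \<open>z\<close>, hence on its difference quotients, and dominated convergence applies to these.
\<close>

lemma holomorphic_on_lebesgue_integral: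
  fixes f :: "complex \<Rightarrow> 'a \<Rightarrow> complex"
  assumes "finite_measure M" and S: "open S"
    and hol: "\<And>\<omega>. \<omega> \<in> space M \<Longrightarrow> (\<lambda>z. f z \<omega>) holomorphic_on S"
    and meas [measurable]: "\<And>z. z \<in> S \<Longrightarrow> f z \<in> borel_measurable M"
    and bound: "\<And>z \<omega>. z \<in> S \<Longrightarrow> \<omega> \<in> space M \<Longrightarrow> norm (f z \<omega>) \<le> C"
  shows "(\<lambda>z. \<integral>\<omega>. f z \<omega> \<partial>M) holomorphic_on S"
  unfolding holomorphic_on_open[OF S]
proof
  interpret finite_measure M by fact
  fix z assume z: "z \<in> S"
  obtain e where e: "0 < e" "ball z e \<subseteq> S" using S z by (auto simp: open_contains_ball)
  define r where "r = e / 2"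
  have r: "0 < r" using e by (simp add: r_def)
  have sub: "cball w (r / 2) \<subseteq> S" if "w \<in> ball z r" for w
  proof
    fix u assume "u \<in> cball w (r / 2)"
    then have "dist z u < e"
      using that dist_triangle[of z u w] r by (auto simp: r_def)
    then show "u \<in> S" using e by auto
  qed
  have zS: "ball z r \<subseteq> S" using e r by (auto simp: r_def)
  have int: "integrable M (f w)" if "w \<in> S" for w
    using that bound by (intro integrable_const_bound[where B = C]) auto
  define g where "g \<omega> = deriv (\<lambda>z. f z \<omega>) z" for \<omega>
  define q where "q w \<omega> = (f w \<omega> - f z \<omega>) / (w - z)" for w \<omega>
  have q_tendsto: "((\<lambda>w. q w \<omega>) \<longlongrightarrow> g \<omega>) (at z within ball z r)" if "\<omega> \<in> space M" for \<omega>
    using holomorphic_derivI[OF hol[OF that] S z] r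
    by (simp add: g_def q_def has_field_derivative_iff at_within_open[of z "ball z r"])
  have q_bound: "norm (q w \<omega>) \<le> C / (r / 2)" if w: "w \<in> ball z r" and \<omega>: "\<omega> \<in> space M" for w \<omega>
  proof -
    have "norm (f w \<omega> - f z \<omega>) \<le> C / (r / 2) * norm (w - z)"
    proof (rule field_differentiable_bound[where S = "ball z r" and f' = "deriv (\<lambda>z. f z \<omega>)"])
      fix u assume u: "u \<in> ball z r"
      show "((\<lambda>z. f z \<omega>) has_field_derivative deriv (\<lambda>z. f z \<omega>) u) (at u within ball z r)"
        by (rule has_field_derivative_at_within, rule holomorphic_derivI[OF hol[OF \<omega>] S])
          (use u zS in auto)
      have "norm ((deriv ^^ 1) (\<lambda>z. f z \<omega>) u) \<le> fact 1 * C / (r / 2) ^ 1"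
      proof (rule Cauchy_inequality)
        show "(\<lambda>z. f z \<omega>) holomorphic_on ball u (r / 2)"
          using sub[OF u] ball_subset_cball by (blast intro: holomorphic_on_subset[OF hol[OF \<omega>]])
        show "continuous_on (cball u (r / 2)) (\<lambda>z. f z \<omega>)"
          using sub[OF u]
          by (blast intro: holomorphic_on_imp_continuous_on holomorphic_on_subset[OF hol[OF \<omega>]])
        show "norm (f x \<omega>) \<le> C" if "norm (u - x) = r / 2" for x
          using sub[OF u] that \<omega> by (intro bound) (auto simp: dist_norm)
      qed (use r in auto)
      then show "norm (deriv (\<lambda>z. f z \<omega>) u) \<le> C / (r / 2)" by simp
    qed (use w r in auto)
    then show ?thesis
      using r bound[OF z \<omega>] by (cases "w = z") (auto simp: q_def norm_divide divide_le_eq order.trans[OF norm_ge_zero])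
  qed
  have "((\<lambda>w. \<integral>\<omega>. q w \<omega> \<partial>M) \<longlongrightarrow> (\<integral>\<omega>. g \<omega> \<partial>M)) (at z within ball z r)"
    unfolding tendsto_at_iff_sequentially
  proof (intro allI impI)
    fix X :: "nat \<Rightarrow> complex"
    assume X: "\<forall>i. X i \<in> ball z r - {z}" "X \<longlonglongrightarrow> z"
    have lim: "(\<lambda>i. q (X i) \<omega>) \<longlonglongrightarrow> g \<omega>" if "\<omega> \<in> space M" for \<omega>
      using q_tendsto[OF that] X unfolding tendsto_at_iff_sequentially by (simp add: o_def)
    have [measurable]: "q (X i) \<in> borel_measurable M" for i
    proof -
      have "X i \<in> S" using X zS by auto
      then show ?thesis using z unfolding q_def[abs_def] by measurable
    qed
    show "((\<lambda>w. \<integral>\<omega>. q w \<omega> \<partial>M) \<circ> X) \<longlonglongrightarrow> (\<integral>\<omega>. g \<omega> \<partial>M)"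
      unfolding o_def
    proof (rule integral_dominated_convergence[where w = "\<lambda>_. C / (r / 2)"])
      show "g \<in> borel_measurable M"
        by (rule borel_measurable_LIMSEQ_metric[where f = "\<lambda>i. q (X i)"]) (use lim in auto)
    qed (use X q_bound lim in auto)
  qed
  moreover have "(\<integral>\<omega>. q w \<omega> \<partial>M) = ((\<integral>\<omega>. f w \<omega> \<partial>M) - (\<integral>\<omega>. f z \<omega> \<partial>M)) / (w - z)"
    if "w \<in> ball z r" for w
    using int[of w] int[of z] that z zS unfolding q_def by (subst Bochner_Integration.integral_diff[symmetric]) auto
  ultimately have "((\<lambda>w. ((\<integral>\<omega>. f w \<omega> \<partial>M) - (\<integral>\<omega>. f z \<omega> \<partial>M)) / (w - z)) \<longlongrightarrow> (\<integral>\<omega>. g \<omega> \<partial>M))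
      (at z within ball z r)"
    by (subst (asm) tendsto_cong) (auto simp: eventually_at_filter)
  then show "\<exists>f'. ((\<lambda>z. \<integral>\<omega>. f z \<omega> \<partial>M) has_field_derivative f') (at z)"
    using r by (intro exI[of _ "\<integral>\<omega>. g \<omega> \<partial>M"])
      (simp add: has_field_derivative_iff at_within_open[of z "ball z r"])
qed

section \<open>Almost sure integrability under the random measure\<close>

lemma borel_measurable_bounded_simple_approx:
  fixes g :: "real \<Rightarrow> real"
  assumes "g \<in> borel_measurable borel"
  obtains s where "\<And>k. simple_function borel (s k)" "\<And>x. (\<lambda>k. s k x) \<longlonglongrightarrow> g x"
    "\<And>k x. \<bar>s k x\<bar> \<le> 2 * \<bar>g x\<bar>"
  using borel_measurable_implies_sequence_metric[OF assms, of 0]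
  by (auto simp: dist_real_def)

lemma integrable_simple_function_finite:
  fixes f :: "real \<Rightarrow> real"
  assumes "finite_measure Q" "sets Q = sets borel" "simple_function borel f"
  shows "integrable Q f"
proof -
  interpret finite_measure Q by fact
  have "simple_function Q f"
    using assms(2,3) sets_eq_imp_space_eq[OF assms(2)] by (simp add: simple_function_def)
  then show ?thesis
    by (rule integrableI_simple_bochner_integrable[OF simple_bochner_integrable.intros]) simp
qed

lemma abs_ln_one_plus_contraction:
  fixes c y :: real
  assumes "0 \<le> c" "c \<le> 1"
  shows "\<bar>ln (1 + c * \<bar>y\<bar>)\<bar> \<le> ln (1 + \<bar>y\<bar>)"
proof -
  have "0 \<le> c * \<bar>y\<bar>" "c * \<bar>y\<bar> \<le> \<bar>y\<bar>"
    using assms by (auto intro: mult_left_le_one_le)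
  then show ?thesis by simp
qed

context dirichlet_random_measure
begin

text \<open>
  For \<open>t > 0\<close> the power \<open>(1 + t \<integral> \<bar>g\<bar> d\<phi>) powr - a\<close>, read as zero where the integral is infinite, is at
  most the indicator of integrability.  Its expectation is at least \<open>exp (- \<integral> ln (1 + 2 t \<bar>g\<bar>) d\<alpha>)\<close> by
  the identity for simple functions, and this bound tends to one as \<open>t\<close> tends to zero.
\<close>

lemma AE_integrable_random_measure:
  fixes g :: "real \<Rightarrow> real"
  assumes g [measurable]: "g \<in> borel_measurable borel"
    and log: "integrable \<alpha> (\<lambda>x. ln (1 + \<bar>g x\<bar>))"
  shows "AE \<omega> in M. integrable (\<phi> \<omega>) g"
proof -
  note sets_param [measurable_cong]
  obtain s where s: "\<And>k. simple_function borel (s k)" "\<And>x. (\<lambda>k. s k x) \<longlonglongrightarrow> g x"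
    "\<And>k x. \<bar>s k x\<bar> \<le> 2 * \<bar>g x\<bar>"
    using borel_measurable_bounded_simple_approx[OF g] by blast
  have [measurable]: "s k \<in> borel_measurable borel" for k
    by (rule borel_measurable_simple_function[OF s(1)])
  define Y where "Y k \<omega> = (\<integral>x. \<bar>s k x\<bar> \<partial>\<phi> \<omega>)" for k \<omega>
  define I where "I = {\<omega> \<in> space M. integrable (\<phi> \<omega>) g}"
  have [measurable]: "I \<in> sets M" unfolding I_def by measurable
  have [measurable]: "Y k \<in> borel_measurable M" for k unfolding Y_def[abs_def] by measurable
  have simple: "simple_function borel (\<lambda>x. h (s k x))" for h :: "real \<Rightarrow> real" and k
    by (rule simple_function_compose1[OF s(1)])
  have s_int: "integrable (\<phi> \<omega>) (\<lambda>x. \<bar>s k x\<bar>)" if "\<omega> \<in> space M" for k \<omega>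
    using integrable_simple_function_finite[OF prob_space.finite_measure[OF
        prob_space_random_measure[OF that]] sets_random_measure[OF that] simple] .
  \<comment> \<open>The factor 2 comes from \<open>\<bar>s k\<bar> \<le> 2 * \<bar>g\<bar>\<close>.\<close>
  have lower: "exp (- (\<integral>x. ln (1 + 2 * t * \<bar>g x\<bar>) \<partial>\<alpha>)) \<le> prob I"
    if t: "0 < t" "t \<le> 1 / 2" for t
  proof -
    define U where "U \<omega> = (if \<omega> \<in> I then (1 + t * (\<integral>x. \<bar>g x\<bar> \<partial>\<phi> \<omega>)) powr - a else 0)" for \<omega>
    have U_meas [measurable]: "U \<in> borel_measurable M" unfolding U_def[abs_def] by measurable
    have lim: "(\<lambda>k. (1 + t * Y k \<omega>) powr - a) \<longlonglongrightarrow> U \<omega>" if \<omega>: "\<omega> \<in> space M" for \<omega>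
    proof (cases "\<omega> \<in> I")
      case True
      note sets_random_measure[OF \<omega>, measurable_cong]
      have gi: "integrable (\<phi> \<omega>) g" using True by (simp add: I_def)
      have "(\<lambda>k. Y k \<omega>) \<longlonglongrightarrow> (\<integral>x. \<bar>g x\<bar> \<partial>\<phi> \<omega>)"
        unfolding Y_def
      proof (rule integral_dominated_convergence[where w = "\<lambda>x. 2 * \<bar>g x\<bar>"])
        show "AE x in \<phi> \<omega>. (\<lambda>k. \<bar>s k x\<bar>) \<longlonglongrightarrow> \<bar>g x\<bar>" by (intro AE_I2 tendsto_intros s(2))
      qed (use gi s(3) in \<open>simp_all add: measurable_cong_sets[OF sets_random_measure[OF \<omega>] refl]\<close>)
      moreover have "0 \<le> (\<integral>x. \<bar>g x\<bar> \<partial>\<phi> \<omega>)" by simp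
      then have "1 + t * (\<integral>x. \<bar>g x\<bar> \<partial>\<phi> \<omega>) \<noteq> 0"
        using t mult_nonneg_nonneg[of t "\<integral>x. \<bar>g x\<bar> \<partial>\<phi> \<omega>"] by linarith
      ultimately show ?thesis
        using True unfolding U_def by (auto intro!: tendsto_intros)
    next
      case False
      note sets_random_measure[OF \<omega>, measurable_cong]
      have "top = (\<integral>\<^sup>+x. ennreal \<bar>g x\<bar> \<partial>\<phi> \<omega>)"
        using False \<omega> by (auto simp: I_def integrable_iff_bounded not_less top_unique)
      also have "(\<integral>\<^sup>+x. ennreal \<bar>g x\<bar> \<partial>\<phi> \<omega>) = (\<integral>\<^sup>+x. liminf (\<lambda>k. ennreal \<bar>s k x\<bar>) \<partial>\<phi> \<omega>)"
        by (intro nn_integral_cong lim_imp_Liminf[symmetric] tendsto_intros s(2)) simp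
      also have "\<dots> \<le> liminf (\<lambda>k. \<integral>\<^sup>+x. ennreal \<bar>s k x\<bar> \<partial>\<phi> \<omega>)"
        by (rule nn_integral_liminf) (simp add: measurable_cong_sets[OF sets_random_measure[OF \<omega>] refl])
      also have "liminf (\<lambda>k. \<integral>\<^sup>+x. ennreal \<bar>s k x\<bar> \<partial>\<phi> \<omega>) = liminf (\<lambda>k. ennreal (Y k \<omega>))"
        using s_int[OF \<omega>] by (simp add: Y_def nn_integral_eq_integral)
      finally have L: "liminf (\<lambda>k. ennreal (Y k \<omega>)) = top" by (simp add: top_unique)
      have "top \<le> limsup (\<lambda>k. ennreal (Y k \<omega>))"
        unfolding L[symmetric] by (rule Liminf_le_Limsup) simp
      then have "(\<lambda>k. ennreal (Y k \<omega>)) \<longlonglongrightarrow> top"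
        using L by (simp add: tendsto_iff_Liminf_eq_Limsup top_unique)
      then have "filterlim (\<lambda>k. Y k \<omega>) at_top sequentially"
        by (simp add: ennreal_tendsto_top_eq_at_top)
      then have "filterlim (\<lambda>k. 1 + t * Y k \<omega>) at_top sequentially"
        using t by (intro filterlim_tendsto_add_at_top[OF tendsto_const]
            filterlim_tendsto_pos_mult_at_top[OF tendsto_const])
      then show ?thesis
        using False a_pos unfolding U_def by (simp add: tendsto_neg_powr)
    qed
    have Y0: "0 \<le> t * Y k \<omega>" for k \<omega> using t by (simp add: Y_def)
    have le1: "(1 + t * Y k \<omega>) powr - a \<le> 1" for k \<omega>
      using powr_mono2'[of "- a" 1 "1 + t * Y k \<omega>"] Y0[of k \<omega>] a_pos by simp
    have "(\<lambda>k. \<integral>\<omega>. (1 + t * Y k \<omega>) powr - a \<partial>M) \<longlonglongrightarrow> (\<integral>\<omega>. U \<omega> \<partial>M)"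
      by (rule integral_dominated_convergence[where w = "\<lambda>_. 1"]) (use lim le1 in auto)
    moreover have "exp (- (\<integral>x. ln (1 + 2 * t * \<bar>g x\<bar>) \<partial>\<alpha>)) \<le> (\<integral>\<omega>. (1 + t * Y k \<omega>) powr - a \<partial>M)" for k
    proof -
      have "(\<integral>x. ln (1 + t * \<bar>s k x\<bar>) \<partial>\<alpha>) \<le> (\<integral>x. ln (1 + 2 * t * \<bar>g x\<bar>) \<partial>\<alpha>)"
      proof (rule integral_mono)
        show "integrable \<alpha> (\<lambda>x. ln (1 + t * \<bar>s k x\<bar>))"
          by (rule integrable_simple_function_finite[OF \<alpha>.finite_measure_axioms sets_param simple])
        show "integrable \<alpha> (\<lambda>x. ln (1 + 2 * t * \<bar>g x\<bar>))"
        proof (rule Bochner_Integration.integrable_bound[OF log])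
          show "AE x in \<alpha>. norm (ln (1 + 2 * t * \<bar>g x\<bar>)) \<le> norm (ln (1 + \<bar>g x\<bar>))"
            using abs_ln_one_plus_contraction[of "2 * t"] t by simp
        qed measurable
        fix x
        have "t * \<bar>s k x\<bar> \<le> t * (2 * \<bar>g x\<bar>)" "0 \<le> t * \<bar>s k x\<bar>"
          using t s(3)[of k x] by (auto intro!: mult_left_mono)
        then show "ln (1 + t * \<bar>s k x\<bar>) \<le> ln (1 + 2 * t * \<bar>g x\<bar>)"
          by (simp add: mult_ac)
      qed
      then have "exp (- (\<integral>x. ln (1 + 2 * t * \<bar>g x\<bar>) \<partial>\<alpha>)) \<le> exp (- (\<integral>x. ln (1 + t * \<bar>s k x\<bar>) \<partial>\<alpha>))"
        by simp
      also have "\<dots> = (\<integral>\<omega>. (\<integral>x. 1 + t * \<bar>s k x\<bar> \<partial>\<phi> \<omega>) powr - a \<partial>M)"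
        by (rule expectation_simple_mean_powr[symmetric, OF simple])
          (use t in \<open>auto intro!: add_pos_nonneg\<close>)
      also have "\<dots> = (\<integral>\<omega>. (1 + t * Y k \<omega>) powr - a \<partial>M)"
      proof (rule Bochner_Integration.integral_cong[OF refl])
        fix \<omega> assume \<omega>: "\<omega> \<in> space M"
        interpret \<phi>: prob_space "\<phi> \<omega>" by (rule prob_space_random_measure[OF \<omega>])
        have "(\<integral>x. 1 + t * \<bar>s k x\<bar> \<partial>\<phi> \<omega>) = 1 + t * Y k \<omega>"
          using s_int[OF \<omega>] by (simp add: Y_def \<phi>.prob_space)
        then show "(\<integral>x. 1 + t * \<bar>s k x\<bar> \<partial>\<phi> \<omega>) powr - a = (1 + t * Y k \<omega>) powr - a" by simp
      qed
      finally show ?thesis .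
    qed
    ultimately have "exp (- (\<integral>x. ln (1 + 2 * t * \<bar>g x\<bar>) \<partial>\<alpha>)) \<le> (\<integral>\<omega>. U \<omega> \<partial>M)"
      by (intro LIMSEQ_le_const) auto
    also have "\<dots> \<le> (\<integral>\<omega>. indicator I \<omega> \<partial>M)"
    proof (rule integral_mono_AE')
      show "AE \<omega> in M. U \<omega> \<le> indicator I \<omega>"
      proof (rule AE_I2)
        fix \<omega>
        have "0 \<le> t * (\<integral>x. \<bar>g x\<bar> \<partial>\<phi> \<omega>)" using t by simp
        then show "U \<omega> \<le> indicator I \<omega>"
          using powr_mono2'[of "- a" 1 "1 + t * (\<integral>x. \<bar>g x\<bar> \<partial>\<phi> \<omega>)"] a_pos
          by (simp add: U_def)
      qed
    qed (auto simp: U_def less_top[symmetric])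
    finally show ?thesis by simp
  qed
  define t where "t n = 1 / (2 * real (Suc n))" for n
  have t: "0 < t n" "t n \<le> 1 / 2" for n by (auto simp: t_def field_simps)
  have "t \<longlonglongrightarrow> 0" unfolding t_def[abs_def] by real_asymp
  then have t_lim: "(\<lambda>n. 1 + 2 * t n * \<bar>g x\<bar>) \<longlonglongrightarrow> 1 + 2 * 0 * \<bar>g x\<bar>" for x
    by (intro tendsto_intros)
  have "(\<lambda>n. \<integral>x. ln (1 + 2 * t n * \<bar>g x\<bar>) \<partial>\<alpha>) \<longlonglongrightarrow> (\<integral>x. 0 \<partial>\<alpha>)"
  proof (rule integral_dominated_convergence[where w = "\<lambda>x. ln (1 + \<bar>g x\<bar>)"])
    show "AE x in \<alpha>. (\<lambda>n. ln (1 + 2 * t n * \<bar>g x\<bar>)) \<longlonglongrightarrow> 0"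
      using tendsto_ln[OF t_lim] by simp
    show "AE x in \<alpha>. norm (ln (1 + 2 * t n * \<bar>g x\<bar>)) \<le> ln (1 + \<bar>g x\<bar>)" for n
      using abs_ln_one_plus_contraction[of "2 * t n"] t[of n] by simp
  qed (use log in auto)
  then have "(\<lambda>n. exp (- (\<integral>x. ln (1 + 2 * t n * \<bar>g x\<bar>) \<partial>\<alpha>))) \<longlonglongrightarrow> exp (- 0)"
    by (intro tendsto_intros) simp
  then have "exp (- 0) \<le> prob I"
    by (rule LIMSEQ_le_const2) (use lower t in auto)
  then have "prob I = 1" using prob_le_1[of I] by simp
  then have "AE \<omega> in M. \<omega> \<in> I" by (simp add: prob_eq_1)
  then show ?thesis by (auto simp: I_def)
qed

end

section \<open>The Markov--Krein identity\<close>

lemma norm_Ln_le: "w \<noteq> 0 \<Longrightarrow> norm (Ln w) \<le> \<bar>ln (norm w)\<bar> + pi"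
  using cmod_le[of "Ln w"] Im_Ln_le_pi[of w] mpi_less_Im_Ln[of w] by simp

lemma norm_one_plus_mult_i_ge: "1 \<le> norm (1 + \<i> * complex_of_real r)"
  using abs_Re_le_cmod[of "1 + \<i> * complex_of_real r"] by simp

lemma norm_one_plus_mult_i_le: "norm (1 + \<i> * complex_of_real r) \<le> 1 + \<bar>r\<bar>"
  using norm_triangle_ineq[of 1 "\<i> * complex_of_real r"] by (simp add: norm_mult)

lemma one_plus_mult_i_nonpos: "1 + \<i> * complex_of_real r \<notin> \<real>\<^sub>\<le>\<^sub>0"
  by (simp add: complex_nonpos_Reals_iff)

lemma norm_Ln_one_plus_mult_i_le:
  "norm (Ln (1 + \<i> * complex_of_real r)) \<le> ln (1 + \<bar>r\<bar>) + pi"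
proof -
  have "norm (Ln (1 + \<i> * complex_of_real r)) \<le> \<bar>ln (norm (1 + \<i> * complex_of_real r))\<bar> + pi"
    using norm_one_plus_mult_i_ge[of r] by (intro norm_Ln_le) auto
  also have "\<bar>ln (norm (1 + \<i> * complex_of_real r))\<bar> \<le> ln (1 + \<bar>r\<bar>)"
  proof -
    have "0 \<le> ln (norm (1 + \<i> * complex_of_real r))"
      using norm_one_plus_mult_i_ge by (rule ln_ge_zero)
    moreover have "ln (norm (1 + \<i> * complex_of_real r)) \<le> ln (1 + \<bar>r\<bar>)"
      using norm_one_plus_mult_i_ge[of r] norm_one_plus_mult_i_le[of r] by (intro ln_mono) auto
    ultimately show ?thesis by linarith
  qed
  finally show ?thesis by simp
qed

lemma norm_exp_Ln_le:
  assumes "0 \<le> a" "0 < d" "d \<le> norm w"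
  shows "norm (exp (- (complex_of_real a * Ln w))) \<le> exp (- (a * ln d))"
proof -
  have "ln d \<le> ln (norm w)" using assms by (intro ln_mono) auto
  then have "a * ln d \<le> a * ln (norm w)" using assms(1) by (rule mult_left_mono)
  moreover have "w \<noteq> 0" using assms by auto
  ultimately show ?thesis by (simp add: norm_exp_eq_Re)
qed

context dirichlet_random_measure
begin

text \<open>
  Both sides extend to holomorphic functions of \<open>z\<close>, with \<open>1 + z v\<close> in place of \<open>1 + i v\<close>, as long as
  \<open>1 + z v\<close> stays in the right half-plane.  They agree for small real \<open>z\<close>, where they are real powers
  and logarithms, hence also at \<open>z = i\<close>.
\<close>

lemma markov_krein_simple:
  fixes v :: "real \<Rightarrow> real"
  assumes v: "simple_function borel v"
  shows "(\<integral>\<omega>. exp (- (of_real a * Ln (1 + \<i> * of_real (\<integral>x. v x \<partial>\<phi> \<omega>)))) \<partial>M) =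
         exp (- (\<integral>x. Ln (1 + \<i> * of_real (v x)) \<partial>\<alpha>))"
proof -
  note sets_param [measurable_cong]
  have v_meas [measurable]: "v \<in> borel_measurable borel" by (rule borel_measurable_simple_function[OF v])
  have fin: "finite (range v)" using simple_functionD(1)[OF v] by simp
  define B where "B = 1 + Max (range (\<lambda>x. \<bar>v x\<bar>))"
  have fin': "finite (range (\<lambda>x. \<bar>v x\<bar>))"
    using finite_imageI[OF fin, of abs] by (simp add: image_image)
  have vB: "\<bar>v x\<bar> \<le> B" for x
    using Max_ge[OF fin', of "\<bar>v x\<bar>"] by (simp add: B_def)
  have "0 \<le> Max (range (\<lambda>x. \<bar>v x\<bar>))"
    by (rule order.trans[OF abs_ge_zero[of "v 0"] Max_ge[OF fin']]) simp
  then have B: "0 < B" by (simp add: B_def)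
  define V where "V \<omega> = (\<integral>x. v x \<partial>\<phi> \<omega>)" for \<omega>
  have [measurable]: "V \<in> borel_measurable M" unfolding V_def[abs_def] by measurable
  have v_int: "integrable (\<phi> \<omega>) v" if "\<omega> \<in> space M" for \<omega>
    using integrable_simple_function_finite[OF prob_space.finite_measure[OF
        prob_space_random_measure[OF that]] sets_random_measure[OF that] v] .
  have VB: "\<bar>V \<omega>\<bar> \<le> B" if \<omega>: "\<omega> \<in> space M" for \<omega>
  proof -
    interpret \<phi>: prob_space "\<phi> \<omega>" by (rule prob_space_random_measure[OF \<omega>])
    have "\<bar>V \<omega>\<bar> \<le> (\<integral>x. \<bar>v x\<bar> \<partial>\<phi> \<omega>)" unfolding V_def by (rule integral_abs_bound)
    also have "\<dots> \<le> (\<integral>x. B \<partial>\<phi> \<omega>)"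
      using v_int[OF \<omega>] vB by (intro integral_mono) auto
    finally show ?thesis by (simp add: \<phi>.prob_space)
  qed
  \<comment> \<open>The bound on the real part keeps \<open>1 + z r\<close> at distance at least \<open>1 / 2\<close> from the left half-plane
    for \<open>\<bar>r\<bar> \<le> B\<close>; the bound on the imaginary part keeps the logarithms bounded and admits \<open>z = i\<close>.\<close>
  define S where "S = box (Complex (- (1 / (2 * B))) (- 2)) (Complex (1 / (2 * B)) 2)"
  have S_iff: "z \<in> S \<longleftrightarrow> \<bar>Re z\<bar> < 1 / (2 * B) \<and> \<bar>Im z\<bar> < 2" for z
    by (auto simp: S_def in_box_complex_iff)
  have S_re: "\<bar>x * r\<bar> \<le> 1 / 2" if "\<bar>x\<bar> < 1 / (2 * B)" "\<bar>r\<bar> \<le> B" for x r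
  proof -
    have "\<bar>x * r\<bar> \<le> 1 / (2 * B) * B" unfolding abs_mult using that by (intro mult_mono) auto
    then show ?thesis using B by simp
  qed
  have Re_ge: "1 / 2 \<le> Re (1 + z * of_real r)" if "z \<in> S" "\<bar>r\<bar> \<le> B" for z r
    using S_re[of "Re z" r] that by (auto simp: S_iff)
  have norm_ge: "1 / 2 \<le> norm (1 + z * of_real r)" if "z \<in> S" "\<bar>r\<bar> \<le> B" for z r
    using Re_ge[OF that] complex_Re_le_cmod[of "1 + z * of_real r"] by linarith
  have norm_le: "norm (1 + z * of_real r) \<le> 2 + 2 * B" if "z \<in> S" "\<bar>r\<bar> \<le> B" for z r
  proof -
    have "norm (1 + z * of_real r) \<le> \<bar>1 + Re z * r\<bar> + \<bar>Im z * r\<bar>"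
      using cmod_le[of "1 + z * of_real r"] by simp
    moreover have "\<bar>Im z * r\<bar> \<le> 2 * B"
      unfolding abs_mult using that by (intro mult_mono) (auto simp: S_iff)
    moreover have "\<bar>Re z * r\<bar> \<le> 1 / 2" using that by (intro S_re) (auto simp: S_iff)
    ultimately show ?thesis by linarith
  qed
  have not_nonpos: "1 + z * of_real r \<notin> \<real>\<^sub>\<le>\<^sub>0" if "z \<in> S" "\<bar>r\<bar> \<le> B" for z r
    using Re_ge[OF that] by (auto simp: complex_nonpos_Reals_iff)
  define L where "L z = (\<integral>\<omega>. exp (- (of_real a * Ln (1 + z * of_real (V \<omega>)))) \<partial>M)" for z
  define K where "K z = (\<integral>x. Ln (1 + z * of_real (v x)) \<partial>\<alpha>)" for z
  have "open S" "convex S" by (auto simp: S_def)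
  have L_hol: "L holomorphic_on S"
    unfolding L_def[abs_def]
  proof (rule holomorphic_on_lebesgue_integral[OF finite_measure_axioms \<open>open S\<close>])
    show "(\<lambda>z. exp (- (of_real a * Ln (1 + z * of_real (V \<omega>))))) holomorphic_on S"
      if "\<omega> \<in> space M" for \<omega>
      using not_nonpos VB[OF that] by (intro holomorphic_intros) auto
    show "norm (exp (- (of_real a * Ln (1 + z * of_real (V \<omega>))))) \<le> exp (- (a * ln (1 / 2)))"
      if "z \<in> S" "\<omega> \<in> space M" for z \<omega>
      using norm_ge[OF that(1) VB[OF that(2)]] a_pos by (intro norm_exp_Ln_le) auto
  qed measurable
  have K_hol: "K holomorphic_on S"
    unfolding K_def[abs_def]
  proof (rule holomorphic_on_lebesgue_integral[OF \<alpha>.finite_measure_axioms \<open>open S\<close>])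
    show "(\<lambda>z. Ln (1 + z * of_real (v x))) holomorphic_on S" for x
      using not_nonpos vB by (intro holomorphic_intros) auto
    show "norm (Ln (1 + z * of_real (v x))) \<le> ln 2 + ln (2 + 2 * B) + pi" if "z \<in> S" for z x
    proof -
      let ?w = "1 + z * of_real (v x)"
      have w: "1 / 2 \<le> norm ?w" "norm ?w \<le> 2 + 2 * B" using norm_ge norm_le that vB by auto
      have "ln (1 / 2) \<le> ln (norm ?w)" "ln (norm ?w) \<le> ln (2 + 2 * B)"
        using w by (auto simp del: ln_le_cancel_iff intro!: ln_mono)
      moreover have "ln (1 / 2) = - ln (2::real)" by (simp add: ln_div)
      moreover have "0 \<le> ln (2::real)" "0 \<le> ln (2 + 2 * B)" using B by auto
      ultimately have "\<bar>ln (norm ?w)\<bar> \<le> ln 2 + ln (2 + 2 * B)" by linarith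
      moreover have "norm (Ln ?w) \<le> \<bar>ln (norm ?w)\<bar> + pi"
        using w by (intro norm_Ln_le) auto
      ultimately show ?thesis by linarith
    qed
  qed measurable
  have real: "L (of_real t) = exp (- K (of_real t))" if t: "\<bar>t\<bar> < 1 / (2 * B)" for t
  proof -
    have pos: "0 < 1 + t * r" if "\<bar>r\<bar> \<le> B" for r using S_re[OF t that] by linarith
    have "L (of_real t) = (\<integral>\<omega>. of_real ((\<integral>x. 1 + t * v x \<partial>\<phi> \<omega>) powr - a) \<partial>M)"
      unfolding L_def
    proof (rule Bochner_Integration.integral_cong[OF refl])
      fix \<omega> assume \<omega>: "\<omega> \<in> space M"
      interpret \<phi>: prob_space "\<phi> \<omega>" by (rule prob_space_random_measure[OF \<omega>])
      have "(\<integral>x. 1 + t * v x \<partial>\<phi> \<omega>) = 1 + t * V \<omega>"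
        using v_int[OF \<omega>] by (simp add: V_def \<phi>.prob_space)
      moreover have "Ln (1 + of_real t * of_real (V \<omega>)) = of_real (ln (1 + t * V \<omega>))"
        using Ln_of_real[OF pos[OF VB[OF \<omega>]]] by simp
      moreover have "0 < 1 + t * V \<omega>" using pos VB \<omega> by simp
      ultimately show "exp (- (of_real a * Ln (1 + of_real t * of_real (V \<omega>)))) =
          of_real ((\<integral>x. 1 + t * v x \<partial>\<phi> \<omega>) powr - a)"
        by (simp add: powr_def exp_of_real[symmetric])
    qed
    also have "\<dots> = of_real (exp (- (\<integral>x. ln (1 + t * v x) \<partial>\<alpha>)))"
      unfolding integral_complex_of_real
      by (subst expectation_simple_mean_powr) (auto intro: simple_function_compose1[OF v] pos vB)
    also have "\<dots> = exp (- of_real (\<integral>x. ln (1 + t * v x) \<partial>\<alpha>))"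
      by (simp flip: exp_of_real)
    also have "of_real (\<integral>x. ln (1 + t * v x) \<partial>\<alpha>) = K (of_real t)"
      unfolding K_def integral_complex_of_real[symmetric]
    proof (rule Bochner_Integration.integral_cong[OF refl])
      fix x
      show "complex_of_real (ln (1 + t * v x)) = Ln (1 + of_real t * of_real (v x))"
        using Ln_of_real[OF pos[OF vB[of x]]] by simp
    qed
    finally show ?thesis .
  qed
  have "L \<i> - exp (- K \<i>) = 0"
  proof (rule analytic_continuation[where f = "\<lambda>z. L z - exp (- K z)" and \<xi> = 0 and S = S
        and U = "of_real ` {- (1 / (2 * B))<..<1 / (2 * B)}"])
    show "(\<lambda>z. L z - exp (- K z)) holomorphic_on S"
      using L_hol K_hol by (intro holomorphic_intros)
    show "connected S" by (rule convex_connected[OF \<open>convex S\<close>])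
    show "(0 :: complex) islimpt of_real ` {- (1 / (2 * B))<..<1 / (2 * B)}"
      unfolding islimpt_approachable
    proof (intro allI impI)
      fix e :: real assume "0 < e"
      then show "\<exists>x'\<in>of_real ` {- (1 / (2 * B))<..<1 / (2 * B)}. x' \<noteq> 0 \<and> dist x' (0::complex) < e"
        using B less_trans[of "- (1 / (2 * B))" 0 "min (e / 2) (1 / (4 * B))"]
        by (intro bexI[of _ "of_real (min (e / 2) (1 / (4 * B)))"] imageI)
          (auto simp: min_less_iff_disj divide_strict_left_mono)
    qed
  qed (use B real \<open>open S\<close> in \<open>auto simp: S_iff\<close>)
  then show ?thesis by (simp add: L_def K_def V_def)
qed

text \<open>
  Simple functions \<open>s k\<close> with \<open>\<bar>s k\<bar> \<le> 2 \<bar>g\<bar>\<close> converge to \<open>g\<close>.  Their random means converge almost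
  surely because \<open>g\<close> is almost surely integrable, and \<open>\<bar>1 + i r\<bar> \<ge> 1\<close> bounds the powers by one.
\<close>

theorem markov_krein:
  fixes g :: "real \<Rightarrow> real"
  assumes g [measurable]: "g \<in> borel_measurable borel"
    and log: "integrable \<alpha> (\<lambda>x. ln (1 + \<bar>g x\<bar>))"
  shows "(\<integral>\<omega>. exp (- (of_real a * Ln (1 + \<i> * of_real (\<integral>x. g x \<partial>\<phi> \<omega>)))) \<partial>M) =
         exp (- (\<integral>x. Ln (1 + \<i> * of_real (g x)) \<partial>\<alpha>))"
proof -
  note sets_param [measurable_cong]
  obtain s where s: "\<And>k. simple_function borel (s k)" "\<And>x. (\<lambda>k. s k x) \<longlonglongrightarrow> g x"
    "\<And>k x. \<bar>s k x\<bar> \<le> 2 * \<bar>g x\<bar>"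
    using borel_measurable_bounded_simple_approx[OF g] by blast
  have [measurable]: "s k \<in> borel_measurable borel" for k
    by (rule borel_measurable_simple_function[OF s(1)])
  have "(\<lambda>k. \<integral>\<omega>. exp (- (of_real a * Ln (1 + \<i> * of_real (\<integral>x. s k x \<partial>\<phi> \<omega>)))) \<partial>M) \<longlonglongrightarrow>
      (\<integral>\<omega>. exp (- (of_real a * Ln (1 + \<i> * of_real (\<integral>x. g x \<partial>\<phi> \<omega>)))) \<partial>M)"
  proof (rule integral_dominated_convergence[where w = "\<lambda>_. 1"])
    show "AE \<omega> in M. (\<lambda>k. exp (- (of_real a * Ln (1 + \<i> * of_real (\<integral>x. s k x \<partial>\<phi> \<omega>))))) \<longlonglongrightarrow>
        exp (- (of_real a * Ln (1 + \<i> * of_real (\<integral>x. g x \<partial>\<phi> \<omega>))))"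
      using AE_integrable_random_measure[OF g log] AE_space
    proof eventually_elim
      case (elim \<omega>)
      note sets_random_measure[OF elim(2), measurable_cong]
      have "(\<lambda>k. \<integral>x. s k x \<partial>\<phi> \<omega>) \<longlonglongrightarrow> (\<integral>x. g x \<partial>\<phi> \<omega>)"
        by (rule integral_dominated_convergence[where w = "\<lambda>x. 2 * \<bar>g x\<bar>"])
          (use elim s in auto)
      then show ?case by (intro tendsto_intros one_plus_mult_i_nonpos)
    qed
    show "AE \<omega> in M. norm (exp (- (of_real a * Ln (1 + \<i> * of_real (\<integral>x. s k x \<partial>\<phi> \<omega>))))) \<le> 1" for k
    proof (rule AE_I2)
      fix \<omega>
      show "norm (exp (- (of_real a * Ln (1 + \<i> * of_real (\<integral>x. s k x \<partial>\<phi> \<omega>))))) \<le> 1"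
        using norm_exp_Ln_le[OF _ zero_less_one norm_one_plus_mult_i_ge, of a] a_pos by simp
    qed
  qed measurable
  moreover have "(\<lambda>k. exp (- (\<integral>x. Ln (1 + \<i> * of_real (s k x)) \<partial>\<alpha>))) \<longlonglongrightarrow>
      exp (- (\<integral>x. Ln (1 + \<i> * of_real (g x)) \<partial>\<alpha>))"
  proof (intro tendsto_intros integral_dominated_convergence[where
        w = "\<lambda>x. ln 2 + ln (1 + \<bar>g x\<bar>) + pi"])
    show "AE x in \<alpha>. (\<lambda>k. Ln (1 + \<i> * of_real (s k x))) \<longlonglongrightarrow> Ln (1 + \<i> * of_real (g x))"
      by (intro AE_I2 tendsto_intros s(2) one_plus_mult_i_nonpos)
    show "AE x in \<alpha>. norm (Ln (1 + \<i> * of_real (s k x))) \<le> ln 2 + ln (1 + \<bar>g x\<bar>) + pi" for k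
    proof (rule AE_I2)
      fix x
      have "ln (1 + \<bar>s k x\<bar>) \<le> ln (2 * (1 + \<bar>g x\<bar>))" using s(3)[of k x] by simp
      also have "\<dots> = ln 2 + ln (1 + \<bar>g x\<bar>)" by (rule ln_mult_pos) auto
      finally show "norm (Ln (1 + \<i> * of_real (s k x))) \<le> ln 2 + ln (1 + \<bar>g x\<bar>) + pi"
        using norm_Ln_one_plus_mult_i_le[of "s k x"] by linarith
    qed
  qed (use log in auto)
  ultimately show ?thesis
    unfolding markov_krein_simple[OF s(1)] by (rule LIMSEQ_unique)
qed

end

section \<open>Recovering a measure from its arctangent integrals\<close>

text \<open>
  As \<open>s\<close> tends to infinity, the integrals of \<open>arctan (s (x - b))\<close> converge to the integrals of the sign of
  \<open>x - b\<close>, up to the factor \<open>\<pi> / 2\<close>.  An atom at \<open>b\<close> is seen neither by the positive nor by the negative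
  part, so the half-line \<open>{b<..}\<close> is reached by letting the threshold decrease to \<open>b\<close>.
\<close>

lemma measure_eq_if_integral_arctan_eq:
  fixes \<mu> \<nu> :: "real measure"
  assumes "finite_measure \<mu>" "finite_measure \<nu>"
    and sets: "sets \<mu> = sets borel" "sets \<nu> = sets borel"
    and mass: "measure \<mu> UNIV = measure \<nu> UNIV"
    and eq: "\<And>s b. (\<integral>x. arctan (s * (x - b)) \<partial>\<mu>) = (\<integral>x. arctan (s * (x - b)) \<partial>\<nu>)"
  shows "\<mu> = \<nu>"
proof (rule measure_eqI_lessThan[OF sets])
  interpret \<mu>: finite_measure \<mu> by fact
  interpret \<nu>: finite_measure \<nu> by fact
  note sets [measurable_cong]
  have lim_arctan: "(\<lambda>n. \<integral>x. arctan (real n * (x - b)) \<partial>\<kappa>) \<longlonglongrightarrow> (\<integral>x. pi / 2 * sgn (x - b) \<partial>\<kappa>)"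
    if "finite_measure \<kappa>" "sets \<kappa> = sets borel" for \<kappa> b
  proof (rule integral_dominated_convergence[where w = "\<lambda>_. pi / 2"])
    interpret finite_measure \<kappa> by fact
    note that(2) [measurable_cong]
    show "integrable \<kappa> (\<lambda>_. pi / 2)" by simp
    show "AE x in \<kappa>. (\<lambda>n. arctan (real n * (x - b))) \<longlonglongrightarrow> pi / 2 * sgn (x - b)"
    proof (rule AE_I2)
      fix x
      consider "x < b" | "x = b" | "b < x" by linarith
      then show "(\<lambda>n. arctan (real n * (x - b))) \<longlonglongrightarrow> pi / 2 * sgn (x - b)"
      proof cases
        case 1
        then have "filterlim (\<lambda>n. real n * (x - b)) at_bot sequentially"
          by real_asymp
        then show ?thesis using 1 filterlim_compose[OF tendsto_arctan_at_bot] by fastforce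
      next
        case 3
        then have "filterlim (\<lambda>n. real n * (x - b)) at_top sequentially"
          by real_asymp
        then show ?thesis using 3 filterlim_compose[OF tendsto_arctan_at_top] by fastforce
      qed simp
    qed
    show "AE x in \<kappa>. norm (arctan (real n * (x - b))) \<le> pi / 2" for n
    proof (rule AE_I2)
      fix x
      show "norm (arctan (real n * (x - b))) \<le> pi / 2"
        using arctan_bounded[of "real n * (x - b)"] by (auto simp: abs_le_iff)
    qed
    show "(\<lambda>x. pi / 2 * sgn (x - b)) \<in> borel_measurable \<kappa>" by measurable
    show "(\<lambda>x. arctan (real n * (x - b))) \<in> borel_measurable \<kappa>" for n by measurable
  qed
  have sgn_eq: "(\<integral>x. sgn (x - b) \<partial>\<mu>) = (\<integral>x. sgn (x - b) \<partial>\<nu>)" for b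
    using LIMSEQ_unique[OF lim_arctan[OF assms(1) sets(1), of b, unfolded eq]
      lim_arctan[OF assms(2) sets(2), of b]] by simp
  have lim_sgn: "(\<lambda>n. \<integral>x. sgn (x - (b + 1 / real (Suc n))) \<partial>\<kappa>) \<longlonglongrightarrow>
      2 * measure \<kappa> {b<..} - measure \<kappa> UNIV"
    if "finite_measure \<kappa>" "sets \<kappa> = sets borel" for \<kappa> b
  proof -
    interpret finite_measure \<kappa> by fact
    note that(2) [measurable_cong]
    have UNIV: "space \<kappa> = UNIV" using sets_eq_imp_space_eq[OF that(2)] by simp
    have "(\<lambda>n. \<integral>x. sgn (x - (b + 1 / real (Suc n))) \<partial>\<kappa>) \<longlonglongrightarrow>
      (\<integral>x. 2 * indicator {b<..} x - 1 \<partial>\<kappa>)"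
    proof (rule integral_dominated_convergence[where w = "\<lambda>_. 1"])
      show "AE x in \<kappa>. (\<lambda>n. sgn (x - (b + 1 / real (Suc n)))) \<longlonglongrightarrow> 2 * indicator {b<..} x - 1"
      proof (rule AE_I2)
        fix x
        show "(\<lambda>n. sgn (x - (b + 1 / real (Suc n)))) \<longlonglongrightarrow> 2 * indicator {b<..} x - 1"
        proof (cases "b < x")
          case True
          have "(\<lambda>n. x - (b + 1 / real (Suc n))) \<longlonglongrightarrow> x - b" by real_asymp
          then have "\<forall>\<^sub>F n in sequentially. 0 < x - (b + 1 / real (Suc n))"
            using True by (intro order_tendstoD(1)) auto
          then have "\<forall>\<^sub>F n in sequentially. sgn (x - (b + 1 / real (Suc n))) = 1"
            by eventually_elim simp
          then show ?thesis using True by (simp add: tendsto_eventually)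
        next
          case False
          have "sgn (x - (b + 1 / real (Suc n))) = - 1" for n
          proof -
            have "0 < 1 / real (Suc n)" by simp
            then have "x - (b + 1 / real (Suc n)) < 0" using False by linarith
            then show ?thesis by (rule sgn_neg)
          qed
          then show ?thesis using False by simp
        qed
      qed
      show "AE x in \<kappa>. norm (sgn (x - (b + 1 / real (Suc n)))) \<le> 1" for n
        by (auto simp: sgn_if)
    qed (simp_all add: measurable_cong_sets[OF that(2) refl])
    also have "(\<integral>x. 2 * indicator {b<..} x - 1 \<partial>\<kappa>) = 2 * measure \<kappa> {b<..} - measure \<kappa> UNIV"
      by (simp add: UNIV less_top[symmetric])
    finally show ?thesis .
  qed
  show "emeasure \<mu> {b<..} < \<infinity>" for b by (simp add: less_top[symmetric])
  show "emeasure \<mu> {b<..} = emeasure \<nu> {b<..}" for b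
    using LIMSEQ_unique[OF lim_sgn[OF assms(1) sets(1), of b, unfolded sgn_eq]
      lim_sgn[OF assms(2) sets(2), of b]] mass
    by (simp add: \<mu>.emeasure_eq_measure \<nu>.emeasure_eq_measure)
qed

lemma continuous_on_integral_arctan:
  assumes "finite_measure \<mu>" "sets \<mu> = sets borel"
  shows "continuous_on UNIV (\<lambda>s. \<integral>x. arctan (s * (x - b)) \<partial>\<mu>)"
  unfolding continuous_on_sequentially o_def
proof (intro allI ballI impI, elim conjE)
  interpret finite_measure \<mu> by fact
  note assms(2) [measurable_cong]
  fix t :: real and u :: "nat \<Rightarrow> real"
  assume u: "u \<longlonglongrightarrow> t"
  show "(\<lambda>n. \<integral>x. arctan (u n * (x - b)) \<partial>\<mu>) \<longlonglongrightarrow> (\<integral>x. arctan (t * (x - b)) \<partial>\<mu>)"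
  proof (rule integral_dominated_convergence[where w = "\<lambda>_. pi / 2"])
    show "AE x in \<mu>. (\<lambda>n. arctan (u n * (x - b))) \<longlonglongrightarrow> arctan (t * (x - b))"
      by (intro AE_I2 tendsto_intros u)
    show "AE x in \<mu>. norm (arctan (u n * (x - b))) \<le> pi / 2" for n
    proof (rule AE_I2)
      fix x
      show "norm (arctan (u n * (x - b))) \<le> pi / 2"
        using arctan_bounded[of "u n * (x - b)"] by (auto simp: abs_le_iff)
    qed
  qed (simp_all add: measurable_cong_sets[OF assms(2) refl])
qed

lemma Im_Ln_one_plus_mult_i: "Im (Ln (1 + \<i> * complex_of_real r)) = arctan r"
proof -
  have "1 + \<i> * complex_of_real r \<noteq> 0" by (simp add: complex_eq_iff)
  then show ?thesis by (simp add: Im_Ln_eq)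
qed

text \<open>
  Equality of the exponentials leaves the imaginary parts of the exponents equal up to an integer
  multiple of \<open>2 \<pi>\<close>.  This multiple is a continuous function of \<open>s\<close>, hence constant, and it is zero at
  \<open>s = 0\<close>.
\<close>

lemma integral_arctan_eq_if_exp_eq:
  assumes fin: "finite_measure \<mu>" "finite_measure \<nu>"
    and sets: "sets \<mu> = sets borel" "sets \<nu> = sets borel"
    and int: "\<And>s. integrable \<mu> (\<lambda>x. Ln (1 + \<i> * complex_of_real (s * (x - b))))"
      "\<And>s. integrable \<nu> (\<lambda>x. Ln (1 + \<i> * complex_of_real (s * (x - b))))"
    and eq: "\<And>s. exp (- (\<integral>x. Ln (1 + \<i> * complex_of_real (s * (x - b))) \<partial>\<mu>)) =
             exp (- (\<integral>x. Ln (1 + \<i> * complex_of_real (s * (x - b))) \<partial>\<nu>))"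
  shows "(\<integral>x. arctan (s * (x - b)) \<partial>\<mu>) = (\<integral>x. arctan (s * (x - b)) \<partial>\<nu>)"
proof -
  define D where "D s = (\<integral>x. arctan (s * (x - b)) \<partial>\<mu>) - (\<integral>x. arctan (s * (x - b)) \<partial>\<nu>)" for s
  have D_discrete: "\<exists>n::int. D s = 2 * pi * of_int n" for s
  proof -
    define A where "A = (\<integral>x. Ln (1 + \<i> * complex_of_real (s * (x - b))) \<partial>\<mu>)"
    define B where "B = (\<integral>x. Ln (1 + \<i> * complex_of_real (s * (x - b))) \<partial>\<nu>)"
    obtain n :: int where "- A = - B + (of_int (2 * n) * pi) * \<i>"
      using eq[of s] unfolding A_def[symmetric] B_def[symmetric] exp_eq by blast
    then have "Im (- A) = Im (- B + (of_int (2 * n) * pi) * \<i>)" by simp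
    then have "- Im A = - Im B + 2 * pi * of_int n" by simp
    moreover have "Im A = (\<integral>x. arctan (s * (x - b)) \<partial>\<mu>)" "Im B = (\<integral>x. arctan (s * (x - b)) \<partial>\<nu>)"
      using integral_Im[OF int(1)[of s]] integral_Im[OF int(2)[of s]]
      by (simp_all only: Im_Ln_one_plus_mult_i A_def B_def)
    ultimately have "D s = - (2 * pi * of_int n)" unfolding D_def by linarith
    then have "D s = 2 * pi * of_int (- n)" by simp
    then show ?thesis by blast
  qed
  have "D constant_on UNIV"
  proof (rule continuous_discrete_range_constant)
    show "connected (UNIV :: real set)" by simp
    show "continuous_on UNIV D"
      unfolding D_def[abs_def]
      by (intro continuous_intros continuous_on_integral_arctan fin sets)
    show "\<exists>e>0. \<forall>t. t \<in> UNIV \<and> D t \<noteq> D s \<longrightarrow> e \<le> norm (D t - D s)" for s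
    proof (intro exI[of _ "2 * pi"] conjI allI impI)
      fix t assume t: "t \<in> UNIV \<and> D t \<noteq> D s"
      obtain m n :: int where mn: "D t = 2 * pi * of_int m" "D s = 2 * pi * of_int n"
        using D_discrete by meson
      then have "1 \<le> \<bar>m - n\<bar>" using t by auto
      then have "1 \<le> \<bar>real_of_int m - real_of_int n\<bar>" by linarith
      then have "2 * pi * 1 \<le> 2 * pi * \<bar>real_of_int m - real_of_int n\<bar>" by (intro mult_left_mono) auto
      then show "2 * pi \<le> norm (D t - D s)"
        unfolding mn by (simp add: abs_mult flip: right_diff_distrib)
    qed simp
  qed
  then obtain c where "D t = c" for t unfolding constant_on_def by blast
  then have "D s = D 0" by simp
  also have "\<dots> = 0" by (simp add: D_def)
  finally show ?thesis by (simp add: D_def)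
qed

section \<open>The parameter is determined by the law of the mean\<close>

context dirichlet_random_measure
begin

lemma
  assumes log: "integrable \<alpha> (\<lambda>x. ln (1 + \<bar>x\<bar>))"
  shows integrable_ln_affine: "integrable \<alpha> (\<lambda>x. ln (1 + \<bar>s * (x - b)\<bar>))"
    and integrable_Ln_affine: "integrable \<alpha> (\<lambda>x. Ln (1 + \<i> * complex_of_real (s * (x - b))))"
proof -
  note sets_param [measurable_cong]
  let ?c = "1 + \<bar>s\<bar> * (1 + \<bar>b\<bar>)"
  have bound: "ln (1 + \<bar>s * (x - b)\<bar>) \<le> ln ?c + ln (1 + \<bar>x\<bar>)" for x
  proof -
    have "\<bar>s\<bar> * \<bar>x - b\<bar> \<le> \<bar>s\<bar> * ((1 + \<bar>b\<bar>) * (1 + \<bar>x\<bar>))"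
    proof (rule mult_left_mono)
      have "\<bar>x - b\<bar> \<le> \<bar>x\<bar> + \<bar>b\<bar>" by (rule abs_triangle_ineq4)
      also have "\<dots> \<le> (1 + \<bar>b\<bar>) * (1 + \<bar>x\<bar>)" by (simp add: algebra_simps)
      finally show "\<bar>x - b\<bar> \<le> (1 + \<bar>b\<bar>) * (1 + \<bar>x\<bar>)" .
    qed simp
    moreover have "?c * (1 + \<bar>x\<bar>) = 1 + \<bar>x\<bar> + \<bar>s\<bar> * ((1 + \<bar>b\<bar>) * (1 + \<bar>x\<bar>))"
      by (simp add: algebra_simps)
    ultimately have "1 + \<bar>s * (x - b)\<bar> \<le> ?c * (1 + \<bar>x\<bar>)"
      unfolding abs_mult by linarith
    then have "ln (1 + \<bar>s * (x - b)\<bar>) \<le> ln (?c * (1 + \<bar>x\<bar>))" by (intro ln_mono) auto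
    also have "\<dots> = ln ?c + ln (1 + \<bar>x\<bar>)"
      by (intro ln_mult_pos) (auto intro!: add_pos_nonneg)
    finally show ?thesis .
  qed
  show ln: "integrable \<alpha> (\<lambda>x. ln (1 + \<bar>s * (x - b)\<bar>))"
  proof (rule Bochner_Integration.integrable_bound[where f = "\<lambda>x. ln ?c + ln (1 + \<bar>x\<bar>)"])
    show "AE x in \<alpha>. norm (ln (1 + \<bar>s * (x - b)\<bar>)) \<le> norm (ln ?c + ln (1 + \<bar>x\<bar>))"
    proof (rule AE_I2)
      fix x
      have "0 \<le> ln (1 + \<bar>s * (x - b)\<bar>)" by simp
      then show "norm (ln (1 + \<bar>s * (x - b)\<bar>)) \<le> norm (ln ?c + ln (1 + \<bar>x\<bar>))"
        using bound[of x] by simp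
    qed
  qed (use log in \<open>simp, measurable\<close>)
  show "integrable \<alpha> (\<lambda>x. Ln (1 + \<i> * complex_of_real (s * (x - b))))"
  proof (rule Bochner_Integration.integrable_bound[where f = "\<lambda>x. ln (1 + \<bar>s * (x - b)\<bar>) + pi"])
    show "AE x in \<alpha>. norm (Ln (1 + \<i> * complex_of_real (s * (x - b)))) \<le>
        norm (ln (1 + \<bar>s * (x - b)\<bar>) + pi)"
    proof (rule AE_I2)
      fix x
      show "norm (Ln (1 + \<i> * complex_of_real (s * (x - b)))) \<le> norm (ln (1 + \<bar>s * (x - b)\<bar>) + pi)"
        using norm_Ln_one_plus_mult_i_le[of "s * (x - b)"] by simp
    qed
  qed (use ln in \<open>simp, measurable\<close>)
qed

lemma markov_krein_mean_distribution:
  assumes log: "integrable \<alpha> (\<lambda>x. ln (1 + \<bar>x\<bar>))"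
  shows "(\<integral>y. exp (- (of_real a * Ln (1 + \<i> * of_real (s * (y - b))))) \<partial>mean_distribution M \<phi>) =
         exp (- (\<integral>x. Ln (1 + \<i> * of_real (s * (x - b))) \<partial>\<alpha>))"
proof -
  have id: "AE \<omega> in M. integrable (\<phi> \<omega>) (\<lambda>x. x)"
    by (rule AE_integrable_random_measure) (use log in auto)
  have "(\<integral>y. exp (- (of_real a * Ln (1 + \<i> * of_real (s * (y - b))))) \<partial>mean_distribution M \<phi>) =
      (\<integral>\<omega>. exp (- (of_real a * Ln (1 + \<i> * of_real (s * ((\<integral>x. x \<partial>\<phi> \<omega>) - b))))) \<partial>M)"
    unfolding mean_distribution_def by (rule integral_distr) measurable
  also have "\<dots> = (\<integral>\<omega>. exp (- (of_real a * Ln (1 + \<i> * of_real (\<integral>x. s * (x - b) \<partial>\<phi> \<omega>)))) \<partial>M)"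
  proof (rule integral_cong_AE)
    show "AE \<omega> in M. exp (- (of_real a * Ln (1 + \<i> * of_real (s * ((\<integral>x. x \<partial>\<phi> \<omega>) - b))))) =
      exp (- (of_real a * Ln (1 + \<i> * of_real (\<integral>x. s * (x - b) \<partial>\<phi> \<omega>))))"
      using id AE_space
    proof eventually_elim
      case (elim \<omega>)
      interpret \<phi>: prob_space "\<phi> \<omega>" by (rule prob_space_random_measure[OF elim(2)])
      show ?case using elim(1) by (simp add: \<phi>.prob_space)
    qed
  qed measurable
  also have "\<dots> = exp (- (\<integral>x. Ln (1 + \<i> * of_real (s * (x - b))) \<partial>\<alpha>))"
    by (rule markov_krein[OF _ integrable_ln_affine[OF log]]) measurable
  finally show ?thesis .
qed

end

theorem theorem2:
  fixes a :: real
    and \<alpha>\<^sub>1 \<alpha>\<^sub>2 :: "real measure"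
    and M\<^sub>1 :: "'w1 measure" and \<phi>\<^sub>1 :: "'w1 \<Rightarrow> real measure"
    and M\<^sub>2 :: "'w2 measure" and \<phi>\<^sub>2 :: "'w2 \<Rightarrow> real measure"
  assumes "0 < a"
    and "\<alpha>\<^sub>1 \<in> log_moment_measures a" and "\<alpha>\<^sub>2 \<in> log_moment_measures a"
    and "dirichlet_process M\<^sub>1 \<phi>\<^sub>1 \<alpha>\<^sub>1" and "dirichlet_process M\<^sub>2 \<phi>\<^sub>2 \<alpha>\<^sub>2"
    and "mean_distribution M\<^sub>1 \<phi>\<^sub>1 = mean_distribution M\<^sub>2 \<phi>\<^sub>2"
  shows "\<alpha>\<^sub>1 = \<alpha>\<^sub>2"
proof -
  interpret D1: dirichlet_random_measure M\<^sub>1 \<phi>\<^sub>1 \<alpha>\<^sub>1 a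
    by standard (use assms in \<open>auto simp: log_moment_measures_def\<close>)
  interpret D2: dirichlet_random_measure M\<^sub>2 \<phi>\<^sub>2 \<alpha>\<^sub>2 a
    by standard (use assms in \<open>auto simp: log_moment_measures_def\<close>)
  have log: "integrable \<alpha> (\<lambda>x. ln (1 + \<bar>x\<bar>))" if "\<alpha> \<in> log_moment_measures a" for \<alpha>
  proof -
    have sets: "sets \<alpha> = sets borel" using that by (simp add: log_moment_measures_def)
    have "(\<lambda>x::real. ln (1 + \<bar>x\<bar>)) \<in> borel_measurable borel" by measurable
    then have "(\<lambda>x. ln (1 + \<bar>x\<bar>)) \<in> borel_measurable \<alpha>"
      by (simp add: measurable_cong_sets[OF sets refl])
    then show ?thesis
      using that by (intro integrableI_nonneg) (auto simp: log_moment_measures_def)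
  qed
  note log = log[OF assms(2)] log[OF assms(3)]
  show ?thesis
  proof (rule measure_eq_if_integral_arctan_eq)
    show "(\<integral>x. arctan (s * (x - b)) \<partial>\<alpha>\<^sub>1) = (\<integral>x. arctan (s * (x - b)) \<partial>\<alpha>\<^sub>2)" for s b
    proof (rule integral_arctan_eq_if_exp_eq)
      show "exp (- (\<integral>x. Ln (1 + \<i> * complex_of_real (s * (x - b))) \<partial>\<alpha>\<^sub>1)) =
        exp (- (\<integral>x. Ln (1 + \<i> * complex_of_real (s * (x - b))) \<partial>\<alpha>\<^sub>2))" for s
        using D1.markov_krein_mean_distribution[OF log(1), of s b]
          D2.markov_krein_mean_distribution[OF log(2), of s b] assms(6) by simp
    qed (use D1.\<alpha>.finite_measure_axioms D2.\<alpha>.finite_measure_axioms D1.sets_param D2.sets_param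
        D1.integrable_Ln_affine[OF log(1)] D2.integrable_Ln_affine[OF log(2)] in auto)
  qed (use D1.\<alpha>.finite_measure_axioms D2.\<alpha>.finite_measure_axioms D1.sets_param D2.sets_param
      D1.measure_param_UNIV D2.measure_param_UNIV in auto)
qed

end
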